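(* Let $H \subset S^{d-1}$ be a finite set of directions, not contained in any closed half-sphere of $S^{d-1}$, for which the family of $H$-convex sets is closed under Minkowski sums. Let $\mathcal{F}$ be a finite family of convex sets in $\mathbb{R}^d$ and $\mu$ be a log-concave measure on $\mathbb{R}^d$. Suppose that the intersection of every $|H|$ or fewer sets in $\mathcal{F}$ contains an $H$-convex set of $\mu$-measure at least one. Then $\bigcap \mathcal{F}$ contains an $H$-convex set of $\mu$-measure at least one.
   Context: $S^{d-1}$ is the unit sphere in $\mathbb{R}^d$. An $H$-halfspace is a set $\{y : \langle y, h\rangle \le \lambda\}$ with $h \in H$, $\lambda \in \mathbb{R}$. A set is $H$-convex if it is an intersection of $H$-halfspaces. A measure $\mu$ is log-concave if $\mu(\lambda A \oplus (1-\lambda) B) \ge \mu(A)^\lambda \mu(B)^{1-\lambda}$ for all Borel sets $A, B$ and $\lambda \in [0,1]$, where $\oplus$ is the Minkowski sum. *)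

theory Defs
  imports "HOL-Analysis.Analysis"
begin

definition H_halfspace :: "'a::euclidean_space set \<Rightarrow> 'a set \<Rightarrow> bool" where
  "H_halfspace H S \<longleftrightarrow> (\<exists>h\<in>H. \<exists>c::real. S = {y. y \<bullet> h \<le> c})"

(* The whole space is H-convex, as the empty intersection. Closure under Minkowski sums forces
   this: two halfspaces with distinct unit normals add up to the whole space. *)
definition H_convex :: "'a::euclidean_space set \<Rightarrow> 'a set \<Rightarrow> bool" where
  "H_convex H K \<longleftrightarrow> (\<exists>\<S>. (\<forall>S\<in>\<S>. H_halfspace H S) \<and> K = \<Inter>\<S>)"

definition closed_half_sphere :: "'a::euclidean_space \<Rightarrow> 'a set" where
  "closed_half_sphere v = {x \<in> sphere 0 1. x \<bullet> v \<ge> 0}"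

(* Real powers of extended nonnegative numbers, for exponents a \<ge> 0. As for powr on the reals,
   0 to the power 0 is 0; log-concavity below needs this when one of the sets is empty. *)
definition ennreal_powr :: "ennreal \<Rightarrow> real \<Rightarrow> ennreal" where
  "ennreal_powr x a =
     (if x = top then (if a = 0 then 1 else top) else ennreal (enn2real x powr a))"

(* The Minkowski sum of two Borel sets is analytic but need not be Borel, so its measure is taken
   as the outer measure, which is the ordinary measure whenever the sum is Borel. *)
definition log_concave_measure :: "'a::euclidean_space measure \<Rightarrow> bool" where
  "log_concave_measure \<mu> \<longleftrightarrow>
     sets \<mu> = sets borel \<and>
     (\<forall>A\<in>sets borel. \<forall>B\<in>sets borel. \<forall>t\<in>{0..1::real}.
        outer_measure_of \<mu> ((\<lambda>x. t *\<^sub>R x) ` A + (\<lambda>x. (1 - t) *\<^sub>R x) ` B)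
          \<ge> ennreal_powr (emeasure \<mu> A) t * ennreal_powr (emeasure \<mu> B) (1 - t))"

end

theory Submission
  imports Defs
begin

text \<open>
  A nonempty $H$-convex set is determined by the suprema of the functionals $h \in H$ on it, and
  closure under Minkowski sums makes these suprema additive: the $H$-convex sets of measure at
  least one form a convex family in $(-\infty, \infty]^H$ by log-concavity. If all suprema are
  finite, apply Radon's theorem in $\mathbb{R}^H$ modulo the constant vectors, a space of dimension
  $|H| - 1$: among $|H| + 1$ sets $K_i \subseteq \bigcap (\mathcal{F} \setminus \{F_i\})$ there are
  two mixtures with disjoint index sets whose suprema differ by a constant, so one mixture contains
  the other, and the smaller one lies in every member of $\mathcal{F}$.

  Unbounded $K_i$ need care, since truncating them may bring the measure below one. Call $i$ bad if
  no bounded $K_i$ of measure at least one exists; then all $H$-convex subsets of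
  $\bigcap (\mathcal{F} \setminus \{F_i\})$ have measure at most one. Truncation and the bounded case
  give $H$-convex sets $Q \subseteq \bigcap \mathcal{F}$ of measure arbitrarily close to one, so that
  log-concavity is almost an equality for the midset of $K_i$ and $Q$. Comparing quantiles along $h$
  in this equality case shows that all bad $K_i$ are unbounded in the same directions of $H$, and
  for such families the Radon argument can be repaired.
\<close>

section \<open>Radon's theorem modulo constants\<close>

text \<open>Gaussian elimination by induction on the equations: one that vanishes identically is
  dropped, any other one eliminates one unknown together with itself.\<close>

lemma homogeneous_system_nontrivial:
  fixes m :: "'b \<Rightarrow> 'c \<Rightarrow> real"
  assumes "finite B" "finite A" "card B < card A"
  shows "\<exists>c. (\<exists>a\<in>A. c a \<noteq> 0) \<and> (\<forall>b\<in>B. (\<Sum>a\<in>A. m b a * c a) = 0)"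
  using assms
proof (induction B arbitrary: A m rule: finite_induct)
  case empty
  then have "A \<noteq> {}" by auto
  then show ?case by (intro exI[of _ "\<lambda>_. 1"]) auto
next
  case (insert b B)
  show ?case
  proof (cases "\<forall>a\<in>A. m b a = 0")
    case True
    have "card B < card A" using insert.prems insert.hyps by simp
    then obtain c where c: "\<exists>a\<in>A. c a \<noteq> 0" "\<forall>b\<in>B. (\<Sum>a\<in>A. m b a * c a) = 0"
      using insert.IH[OF insert.prems(1)] by blast
    moreover have "(\<Sum>a\<in>A. m b a * c a) = 0" using True by (intro sum.neutral) auto
    ultimately show ?thesis by (intro exI[of _ c]) auto
  next
    case False
    then obtain p where p: "p \<in> A" "m b p \<noteq> 0" by blast
    define A' where "A' = A - {p}"
    have A: "A = insert p A'" "p \<notin> A'" "finite A'" using p insert.prems by (auto simp: A'_def)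
    \<comment> \<open>The system left after the equation \<open>b\<close>, solved for the pivot
      unknown \<open>p\<close>, is substituted into the others; the value at \<open>p\<close> is
      recovered from \<open>b\<close> afterwards.\<close>
    define m' where "m' b' a = m b' a - m b' p * m b a / m b p" for b' a
    have "card B < card A'" using insert.prems insert.hyps p by (simp add: A'_def)
    then obtain c where c: "\<exists>a\<in>A'. c a \<noteq> 0" "\<forall>b'\<in>B. (\<Sum>a\<in>A'. m' b' a * c a) = 0"
      using insert.IH[OF A(3)] by blast
    define c' where "c' = c(p := - (\<Sum>a\<in>A'. m b a * c a) / m b p)"
    have eq: "(\<Sum>a\<in>A. m b' a * c' a)
        = (\<Sum>a\<in>A'. m b' a * c a) - m b' p * (\<Sum>a\<in>A'. m b a * c a) / m b p" for b'
    proof -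
      have "(\<Sum>a\<in>A'. m b' a * c' a) = (\<Sum>a\<in>A'. m b' a * c a)"
        using A(2) by (intro sum.cong) (auto simp: c'_def)
      then show ?thesis unfolding A(1) using A(2,3) by (simp add: c'_def)
    qed
    have "(\<Sum>a\<in>A. m b' a * c' a) = 0" if "b' \<in> B" for b'
    proof -
      have "(\<Sum>a\<in>A'. m' b' a * c a)
          = (\<Sum>a\<in>A'. m b' a * c a) - m b' p * (\<Sum>a\<in>A'. m b a * c a) / m b p"
        by (simp add: m'_def left_diff_distrib sum_subtractf sum_distrib_left sum_divide_distrib
            mult.assoc)
      with c(2) that eq show ?thesis by simp
    qed
    moreover have "(\<Sum>a\<in>A. m b a * c' a) = 0" using p by (simp add: eq)
    moreover have "\<exists>a\<in>A. c' a \<noteq> 0" using c(1) A(1,2) by (auto simp: c'_def)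
    ultimately show ?thesis by (intro exI[of _ c']) auto
  qed
qed

text \<open>The constant \<open>s\<close> counts as one more unknown and the condition
  \<open>sum d T = 0\<close> as one more equation, so the unknowns still outnumber the
  equations.\<close>

lemma affine_dependence_modulo_constants:
  fixes a :: "'i \<Rightarrow> 'h \<Rightarrow> real"
  assumes "finite T" "finite E" "E \<noteq> {}" "card E < card T"
  shows "\<exists>d s. s \<ge> 0 \<and> (\<exists>i\<in>T. d i \<noteq> 0) \<and> sum d T = 0 \<and> (\<forall>h\<in>E. (\<Sum>i\<in>T. d i * a i h) = s)"
proof -
  \<comment> \<open>Among the equations, \<open>None\<close> is the condition on the sum of the
    coefficients; among the unknowns, \<open>None\<close> is \<open>s\<close>, with coefficient -1
    in the equation of every direction.\<close>
  define m where "m b i = (case (b, i) of (None, None) \<Rightarrow> 0 | (None, Some i) \<Rightarrow> 1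
      | (Some h, None) \<Rightarrow> -1 | (Some h, Some i) \<Rightarrow> a i h)" for b :: "'h option" and i :: "'i option"
  define B where "B = insert None (Some ` E)"
  define A where "A = insert None (Some ` T)"
  have fin: "finite B" "finite A" using assms by (auto simp: A_def B_def)
  have "card B = Suc (card E)" "card A = Suc (card T)"
    using assms by (auto simp: A_def B_def card_image)
  with assms have "card B < card A" by simp
  from homogeneous_system_nontrivial[OF fin this, of m] obtain c where
    c: "\<exists>a\<in>A. c a \<noteq> 0" "\<forall>b\<in>B. (\<Sum>a\<in>A. m b a * c a) = 0" by blast
  define d where "d = c \<circ> Some"
  have split: "(\<Sum>a\<in>A. m b a * c a) = m b None * c None + (\<Sum>i\<in>T. m b (Some i) * d i)" for b
    using assms by (simp add: A_def sum.reindex d_def)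
  have 1: "sum d T = 0" using c(2) split[of None] by (simp add: B_def m_def)
  have 2: "\<forall>h\<in>E. (\<Sum>i\<in>T. d i * a i h) = c None"
  proof
    fix h assume "h \<in> E"
    then have "(\<Sum>a\<in>A. m (Some h) a * c a) = 0" using c(2) by (simp add: B_def)
    then show "(\<Sum>i\<in>T. d i * a i h) = c None"
      unfolding split by (simp add: m_def mult.commute)
  qed
  \<comment> \<open>If all \<open>d i\<close> vanished, the equation of any \<open>h \<in> E\<close>
    would force \<open>s\<close> to vanish too, and the solution would be trivial.\<close>
  have 3: "\<exists>i\<in>T. d i \<noteq> 0"
  proof (rule ccontr)
    assume *: "\<not> (\<exists>i\<in>T. d i \<noteq> 0)"
    with 2 assms(3) have "c None = 0" by force
    with * c(1) show False by (auto simp: A_def d_def)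
  qed
  show ?thesis
  proof (cases "c None \<ge> 0")
    case True with 1 2 3 show ?thesis by blast
  next
    case False
    with 1 2 3 show ?thesis
      by (intro exI[of _ "\<lambda>i. - d i"] exI[of _ "- c None"]) (auto simp: sum_negf)
  qed
qed

text \<open>The positive and the negative coefficients of the dependence have the same total up to
  sign; dividing by it turns both groups into weights of a convex combination.\<close>

lemma radon_modulo_constants:
  fixes a :: "'i \<Rightarrow> 'h \<Rightarrow> real"
  assumes "finite T" "finite E" "E \<noteq> {}" "card E < card T"
  obtains I J s d e where
    "I \<subseteq> T" "J \<subseteq> T" "I \<inter> J = {}" "I \<noteq> {}" "J \<noteq> {}" "s \<ge> 0"
    "\<forall>i\<in>I. d i > 0" "\<forall>i\<in>J. e i > 0" "sum d I = (1::real)" "sum e J = (1::real)"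
    "\<forall>h\<in>E. (\<Sum>i\<in>I. d i * a i h) = (\<Sum>i\<in>J. e i * a i h) + s"
proof -
  obtain d s where s: "s \<ge> 0" and d: "\<exists>i\<in>T. d i \<noteq> 0" "sum d T = 0"
    and eq: "\<And>h. h \<in> E \<Longrightarrow> (\<Sum>i\<in>T. d i * a i h) = s"
    using affine_dependence_modulo_constants[OF assms, of a] by blast
  define I where "I = {i\<in>T. d i > 0}"
  define J where "J = {i\<in>T. d i < 0}"
  have fin: "finite I" "finite J" using assms(1) by (auto simp: I_def J_def)
  have split: "sum (\<lambda>i. d i * g i) T = sum (\<lambda>i. d i * g i) I + sum (\<lambda>i. d i * g i) J" for g
  proof -
    have "sum (\<lambda>i. d i * g i) T = sum (\<lambda>i. d i * g i) (I \<union> J)"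
      using assms(1) by (intro sum.mono_neutral_right) (auto simp: I_def J_def)
    also have "\<dots> = sum (\<lambda>i. d i * g i) I + sum (\<lambda>i. d i * g i) J"
      using fin by (intro sum.union_disjoint) (auto simp: I_def J_def)
    finally show ?thesis .
  qed
  define D where "D = sum d I"
  have DJ: "sum d J = - D" using split[of "\<lambda>_. 1"] d(2) by (simp add: D_def)
  have D: "D > 0" "I \<noteq> {}" "J \<noteq> {}"
  proof -
    have *: "D > 0" if "I \<noteq> {}" using that fin unfolding D_def by (intro sum_pos) (auto simp: I_def)
    have **: "sum (\<lambda>i. - d i) J > 0" if "J \<noteq> {}" using that fin by (intro sum_pos) (auto simp: J_def)
    have "I \<noteq> {} \<or> J \<noteq> {}" using d(1) by (auto simp: I_def J_def) (metis linorder_neqE_linordered_idom)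
    then show "D > 0" using * ** DJ by (auto simp: sum_negf)
    then show "I \<noteq> {}" "J \<noteq> {}" using DJ by (auto simp: D_def)
  qed
  show ?thesis
  proof (rule that[of I J "s / D" "\<lambda>i. d i / D" "\<lambda>i. - d i / D"])
    have "(\<Sum>i\<in>I. d i / D * a i h) = (\<Sum>i\<in>J. - d i / D * a i h) + s / D" if "h \<in> E" for h
    proof -
      have "(\<Sum>i\<in>I. d i * a i h) + (\<Sum>i\<in>J. d i * a i h) = s" using eq split that by simp
      then have "((\<Sum>i\<in>I. d i * a i h) + (\<Sum>i\<in>J. d i * a i h)) / D = s / D" by simp
      then show ?thesis
        by (simp add: sum_divide_distrib add_divide_distrib sum_negf algebra_simps)
    qed
    then show "\<forall>h\<in>E. (\<Sum>i\<in>I. d i / D * a i h) = (\<Sum>i\<in>J. - d i / D * a i h) + s / D" by blast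
  next
    show "(\<Sum>i\<in>I. d i / D) = 1" using D by (simp add: D_def sum_divide_distrib[symmetric])
    show "(\<Sum>i\<in>J. - d i / D) = 1" using D DJ by (simp add: sum_negf sum_divide_distrib[symmetric])
  qed (use s D in \<open>auto simp: I_def J_def divide_neg_pos\<close>)
qed

section \<open>Weighted Minkowski sums and H-convex sets\<close>

text \<open>Radon's theorem delivers index sets with weights, so Minkowski combinations are indexed
  in the same way. The weights need not sum to one, which keeps rescaling and induction on
  \<open>I\<close> within the notion.\<close>

definition wmix :: "'i set \<Rightarrow> ('i \<Rightarrow> real) \<Rightarrow> ('i \<Rightarrow> 'a::real_vector set) \<Rightarrow> 'a set" where
  "wmix I d K = {\<Sum>i\<in>I. d i *\<^sub>R x i |x. \<forall>i\<in>I. x i \<in> K i}"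

text \<open>Passage to binary Minkowski sums, the form in which closure of H-convex sets and
  log-concavity are available.\<close>

lemma wmix_insert:
  assumes "finite I" "i \<notin> I"
  shows "wmix (insert i I) d K = (\<lambda>x. d i *\<^sub>R x) ` K i + wmix I d K"
proof -
  have "\<exists>z. d i *\<^sub>R u + (\<Sum>j\<in>I. d j *\<^sub>R x j) = (\<Sum>j\<in>insert i I. d j *\<^sub>R z j) \<and> (\<forall>j\<in>insert i I. z j \<in> K j)"
    if "u \<in> K i" "\<forall>j\<in>I. x j \<in> K j" for u x
  proof (intro exI conjI)
    show "\<forall>j\<in>insert i I. (x(i := u)) j \<in> K j" using that by auto
    have "(\<Sum>j\<in>I. d j *\<^sub>R (x(i := u)) j) = (\<Sum>j\<in>I. d j *\<^sub>R x j)"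
      using assms by (intro sum.cong) auto
    then show "d i *\<^sub>R u + (\<Sum>j\<in>I. d j *\<^sub>R x j) = (\<Sum>j\<in>insert i I. d j *\<^sub>R (x(i := u)) j)"
      using assms by simp
  qed
  then show ?thesis using assms
    by (auto simp: wmix_def set_plus_def)
qed

lemma scaleR_image_wmix:
  fixes K :: "'i \<Rightarrow> 'a::real_vector set"
  shows "(\<lambda>x. r *\<^sub>R x) ` wmix I d K = wmix I (\<lambda>i. r * d i) K"
proof -
  have "(\<Sum>i\<in>I. (r * d i) *\<^sub>R x i) = r *\<^sub>R (\<Sum>i\<in>I. d i *\<^sub>R x i)" for x :: "'i \<Rightarrow> 'a"
    by (simp add: scaleR_sum_right)
  then have "wmix I (\<lambda>i. r * d i) K = {r *\<^sub>R (\<Sum>i\<in>I. d i *\<^sub>R x i) |x. \<forall>i\<in>I. x i \<in> K i}"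
    by (simp only: wmix_def)
  then show ?thesis unfolding wmix_def by blast
qed

lemma wmix_subset_convex:
  assumes "finite I" "convex F" "\<And>i. i \<in> I \<Longrightarrow> K i \<subseteq> F" "\<And>i. i \<in> I \<Longrightarrow> d i \<ge> 0" "sum d I = 1"
  shows "wmix I d K \<subseteq> F"
  using assms by (auto simp: wmix_def intro!: convex_sum)

lemma wmix_inner_le:
  assumes "y \<in> wmix I d K" "\<And>i. i \<in> I \<Longrightarrow> d i \<ge> 0" "\<And>i x. i \<in> I \<Longrightarrow> x \<in> K i \<Longrightarrow> x \<bullet> h \<le> b i"
  shows "y \<bullet> h \<le> (\<Sum>i\<in>I. d i * b i)"
  using assms by (auto simp: wmix_def inner_sum_left intro!: sum_mono mult_left_mono)

lemma wmix_inner_ge: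
  assumes "\<And>i. i \<in> I \<Longrightarrow> d i \<ge> 0" "\<And>i. i \<in> I \<Longrightarrow> \<exists>x\<in>K i. x \<bullet> h \<ge> b i"
  shows "\<exists>y\<in>wmix I d K. y \<bullet> h \<ge> (\<Sum>i\<in>I. d i * b i)"
proof -
  obtain x where x: "\<And>i. i \<in> I \<Longrightarrow> x i \<in> K i \<and> x i \<bullet> h \<ge> b i" using assms(2) by metis
  have "(\<Sum>i\<in>I. d i *\<^sub>R x i) \<in> wmix I d K" using x by (auto simp: wmix_def)
  moreover have "(\<Sum>i\<in>I. d i *\<^sub>R x i) \<bullet> h \<ge> (\<Sum>i\<in>I. d i * b i)"
    using x assms(1) by (auto simp: inner_sum_left intro!: sum_mono mult_left_mono)
  ultimately show ?thesis by blast
qed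

section \<open>Bounded directions and support values\<close>

definition bounded_in :: "'a::real_inner set \<Rightarrow> 'a \<Rightarrow> bool" where
  "bounded_in K h \<longleftrightarrow> bdd_above ((\<lambda>x. x \<bullet> h) ` K)"

text \<open>The support function with real values: where it would be infinite,
  \<open>bounded_in\<close> fails and the value of \<open>supp\<close> carries no
  information.\<close>

abbreviation supp :: "'a::real_inner set \<Rightarrow> 'a \<Rightarrow> real" where
  "supp K h \<equiv> (SUP x\<in>K. x \<bullet> h)"

lemma supp_upper: "bounded_in K h \<Longrightarrow> x \<in> K \<Longrightarrow> x \<bullet> h \<le> supp K h"
  unfolding bounded_in_def by (rule cSUP_upper)

lemma supp_approx:
  assumes "bounded_in K h" "K \<noteq> {}" "e > 0"
  shows "\<exists>x\<in>K. x \<bullet> h \<ge> supp K h - e"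
  using less_cSUP_iff[OF assms(2) assms(1)[unfolded bounded_in_def], of "supp K h - e"] assms(3) by (auto intro: less_imp_le)

lemma not_bounded_inD: "\<not> bounded_in K h \<Longrightarrow> \<exists>x\<in>K. x \<bullet> h \<ge> r"
  unfolding bounded_in_def bdd_above_def by (auto simp: not_le) (meson less_imp_le)

text \<open>A single unbounded summand with positive weight offsets whatever the others
  contribute.\<close>

lemma wmix_unbounded:
  assumes "finite I" "\<And>i. i \<in> I \<Longrightarrow> d i > 0" "\<And>i. i \<in> I \<Longrightarrow> K i \<noteq> {}" "j \<in> I" "\<not> bounded_in (K j) h"
  shows "\<exists>y\<in>wmix I d K. y \<bullet> h \<ge> r"
proof -
  obtain x where x: "\<And>i. i \<in> I \<Longrightarrow> x i \<in> K i" using bchoice[of I "\<lambda>i x. x \<in> K i"] assms(3) by auto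
  define rest where "rest = (\<Sum>i\<in>I-{j}. d i * (x i \<bullet> h))"
  \<comment> \<open>\<open>b j\<close> is solved from the requirement that the weighted total equal
    \<open>r\<close>.\<close>
  define b where "b i = (if i = j then (r - rest) / d j else x i \<bullet> h)" for i
  have "\<exists>x\<in>K i. x \<bullet> h \<ge> b i" if "i \<in> I" for i
    using not_bounded_inD[OF assms(5)] x that by (auto simp: b_def)
  then obtain y where y: "y \<in> wmix I d K" "y \<bullet> h \<ge> (\<Sum>i\<in>I. d i * b i)"
    using wmix_inner_ge[of I d K b h] assms(2) by (meson less_imp_le)
  have "(\<Sum>i\<in>I-{j}. d i * b i) = rest" unfolding rest_def by (intro sum.cong) (auto simp: b_def)
  then have "(\<Sum>i\<in>I. d i * b i) = d j * b j + rest" using assms(1,4) by (simp add: sum.remove)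
  also have "\<dots> = r" using assms(2)[OF assms(4)] by (simp add: b_def)
  finally show ?thesis using y by auto
qed

section \<open>Operations on H-convex sets\<close>

lemma H_convex_truncate:
  assumes "H_convex H K" "H' \<subseteq> H"
  shows "H_convex H (K \<inter> {x. \<forall>h\<in>H'. x \<bullet> h \<le> r h})"
proof -
  obtain \<S> where S: "\<forall>S\<in>\<S>. H_halfspace H S" "K = \<Inter>\<S>" using assms(1) by (auto simp: H_convex_def)
  have "\<forall>S\<in>\<S> \<union> (\<lambda>h. {x. x \<bullet> h \<le> r h}) ` H'. H_halfspace H S"
    using S(1) assms(2) by (auto simp: H_halfspace_def)
  moreover have "K \<inter> {x. \<forall>h\<in>H'. x \<bullet> h \<le> r h} = \<Inter>(\<S> \<union> (\<lambda>h. {x. x \<bullet> h \<le> r h}) ` H')"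
    using S(2) by auto
  ultimately show ?thesis unfolding H_convex_def by blast
qed

lemma H_convex_closed:
  assumes "H_convex H K" shows "closed K"
proof -
  have "closed S" if "H_halfspace H S" for S
    using that by (auto simp: H_halfspace_def inner_commute[of _ "_::'a"] closed_halfspace_le)
  then show ?thesis using assms by (auto simp: H_convex_def)
qed

lemma H_convex_borel: "H_convex H K \<Longrightarrow> K \<in> sets borel"
  by (simp add: H_convex_closed)

text \<open>Scaling by a positive factor is a bijection, so it commutes with all intersections, the
  empty one included, and it maps H-halfspaces to H-halfspaces.\<close>

lemma H_convex_scaleR:
  assumes "H_convex H K" "r > 0"
  shows "H_convex H ((\<lambda>x. r *\<^sub>R x) ` K)"
proof -
  obtain \<S> where S: "\<forall>S\<in>\<S>. H_halfspace H S" "K = \<Inter>\<S>" using assms(1) by (auto simp: H_convex_def)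
  have img: "(\<lambda>x. r *\<^sub>R x) ` {y. y \<bullet> h \<le> c} = {y. y \<bullet> h \<le> r * c}" for h :: 'a and c
  proof -
    have "x \<in> (\<lambda>x. r *\<^sub>R x) ` {y. y \<bullet> h \<le> c}" if "x \<bullet> h \<le> r * c" for x
      using that assms(2) by (intro image_eqI[of _ _ "(1/r) *\<^sub>R x"]) (auto simp: field_simps)
    then show ?thesis using assms(2) by auto
  qed
  have "inj (\<lambda>x::'a. r *\<^sub>R x)" using assms(2) by (auto simp: inj_on_def)
  moreover have "surj (\<lambda>x::'a. r *\<^sub>R x)" using assms(2) by (intro surjI[of _ "\<lambda>x. (1/r) *\<^sub>R x"]) auto
  ultimately have "bij (\<lambda>x::'a. r *\<^sub>R x)" by (simp add: bij_def)
  then have "(\<lambda>x. r *\<^sub>R x) ` K = \<Inter>((`) (\<lambda>x. r *\<^sub>R x) ` \<S>)" unfolding S(2) by (rule bij_image_INT[where B="\<lambda>x. x", simplified])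
  moreover have "\<forall>S\<in>(`) (\<lambda>x. r *\<^sub>R x) ` \<S>. H_halfspace H S"
    using S(1) img by (fastforce simp: H_halfspace_def)
  ultimately show ?thesis unfolding H_convex_def by blast
qed

text \<open>Each halfspace in a representation of \<open>P\<close> itself contains \<open>P\<close>.
  Inclusions thus reduce to inequalities in the directions of \<open>H\<close>.\<close>

lemma H_convex_subsetI:
  assumes "H_convex H P" "\<And>h c x. h \<in> H \<Longrightarrow> P \<subseteq> {y. y \<bullet> h \<le> c} \<Longrightarrow> x \<in> Q \<Longrightarrow> x \<bullet> h \<le> c"
  shows "Q \<subseteq> P"
proof -
  obtain \<S> where S: "\<forall>S\<in>\<S>. H_halfspace H S" "P = \<Inter>\<S>" using assms(1) by (auto simp: H_convex_def)
  show ?thesis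
  proof
    fix x assume x: "x \<in> Q"
    have "x \<in> S" if SS: "S \<in> \<S>" for S
    proof -
      obtain h c where "h \<in> H" "S = {y. y \<bullet> h \<le> c}" using S(1) SS by (auto simp: H_halfspace_def)
      then show ?thesis using assms(2)[of h c x] x S(2) SS by auto
    qed
    then show "x \<in> P" using S(2) by auto
  qed
qed

lemma ennreal_powr_ge:
  assumes "ennreal a \<le> x" "a > 0" "0 < t"
  shows "ennreal (a powr t) \<le> ennreal_powr x t"
proof (cases "x = top")
  case False
  then obtain y where "x = ennreal y" "y \<ge> 0" by (cases x) auto
  with assms show ?thesis
    by (auto simp: ennreal_powr_def ennreal_le_iff intro!: ennreal_leI powr_mono2)
qed (use assms in \<open>auto simp: ennreal_powr_def\<close>)

lemma borel_halfspaces [measurable]: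
  fixes h :: "'b::euclidean_space"
  shows "{y. y \<bullet> h \<le> x} \<in> sets borel" "{y. y \<bullet> h \<ge> x} \<in> sets borel" "{y. y \<bullet> h > x} \<in> sets borel"
  by measurable

text \<open>The levels \<open>1 / (k + 2)\<close> are strictly log-convex, as (k + 2)(k + 4) = (k +
  3)^2 - 1, so every inequality holds at c = 1. By continuity, finitely many of them persist for
  some c < 1.\<close>

lemma log_convex_levels:
  "\<exists>c::real. 1/2 < c \<and> c < 1 \<and> (\<forall>k<N. sqrt (1 / real (k + 4)) * sqrt (1 / real (k + 2))
      + sqrt (1 - 1 / real (k + 3)) * sqrt (c - 1 / real (k + 3)) > 1)"
proof -
  have ev: "\<forall>\<^sub>F c in at_left 1. sqrt (1 / real (k + 4)) * sqrt (1 / real (k + 2))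
      + sqrt (1 - 1 / real (k + 3)) * sqrt (c - 1 / real (k + 3)) > 1" for k
  proof (rule order_tendstoD(1))
    show "((\<lambda>c. sqrt (1 / real (k + 4)) * sqrt (1 / real (k + 2))
      + sqrt (1 - 1 / real (k + 3)) * sqrt (c - 1 / real (k + 3))) \<longlongrightarrow>
      sqrt (1 / real (k + 4)) * sqrt (1 / real (k + 2))
      + sqrt (1 - 1 / real (k + 3)) * sqrt (1 - 1 / real (k + 3))) (at_left 1)"
      by (intro tendsto_intros)
    have "sqrt (1 / real (k + 4)) * sqrt (1 / real (k + 2)) = sqrt (1 / (real (k + 4) * real (k + 2)))"
      by (simp add: real_sqrt_mult[symmetric])
    also have "\<dots> > sqrt ((1 / real (k + 3))\<^sup>2)"
    proof (rule real_sqrt_less_mono)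
      have "1 / (real (k + 3))\<^sup>2 < 1 / (real (k + 4) * real (k + 2))"
        by (intro divide_strict_left_mono) (simp_all add: power2_eq_square algebra_simps add_pos_nonneg)
      then show "(1 / real (k + 3))\<^sup>2 < 1 / (real (k + 4) * real (k + 2))" by (simp add: power_one_over)
    qed
    finally have "sqrt (1 / real (k + 4)) * sqrt (1 / real (k + 2)) > 1 / real (k + 3)" by simp
    moreover have "sqrt (1 - 1 / real (k + 3)) * sqrt (1 - 1 / real (k + 3)) = 1 - 1 / real (k + 3)"
      by (simp add: real_sqrt_mult_self)
    ultimately show "1 < sqrt (1 / real (k + 4)) * sqrt (1 / real (k + 2))
      + sqrt (1 - 1 / real (k + 3)) * sqrt (1 - 1 / real (k + 3))" by linarith
  qed
  have "\<forall>\<^sub>F c::real in at_left 1. c \<in> {1/2<..<1}" by (intro eventually_at_left_real) auto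
  moreover have "\<forall>\<^sub>F c in at_left 1. \<forall>k\<in>{..<N}. sqrt (1 / real (k + 4)) * sqrt (1 / real (k + 2))
      + sqrt (1 - 1 / real (k + 3)) * sqrt (c - 1 / real (k + 3)) > 1"
    using ev by (intro eventually_ball_finite) auto
  ultimately have "\<forall>\<^sub>F c in at_left (1::real). 1/2 < c \<and> c < 1 \<and> (\<forall>k<N. sqrt (1 / real (k + 4)) * sqrt (1 / real (k + 2))
      + sqrt (1 - 1 / real (k + 3)) * sqrt (c - 1 / real (k + 3)) > 1)"
    by eventually_elim auto
  then show ?thesis using eventually_happens by fastforce
qed

section \<open>Mixtures of H-convex sets\<close>

text \<open>The half-sphere condition is used through two consequences: \<open>H\<close> has at
  least two directions, and \<open>{0}\<close> is H-convex.\<close>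

locale H_setting =
  fixes H :: "'a::euclidean_space set" and \<mu> :: "'a measure"
  assumes finite_H: "finite H"
    and card_H: "card H \<ge> 2"
    and H_convex_zero: "H_convex H {0}"
    and H_convex_plus: "\<And>A B. H_convex H A \<Longrightarrow> H_convex H B \<Longrightarrow> H_convex H (A + B)"
    and log_concave: "log_concave_measure \<mu>"
begin

lemma sets_eq [simp]: "sets \<mu> = sets borel"
  using log_concave by (simp add: log_concave_measure_def)

text \<open>A Minkowski sum need not be Borel, so a Borel set \<open>C\<close> around it is measured
  instead. Real lower bounds replace the measures themselves, so that infinite values need no
  separate treatment later.\<close>

lemma log_concave_bound:
  assumes "A \<in> sets borel" "B \<in> sets borel" "C \<in> sets borel" "0 < t" "t < 1"
    and "(\<lambda>x. t *\<^sub>R x) ` A + (\<lambda>x. (1 - t) *\<^sub>R x) ` B \<subseteq> C"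
    and "ennreal a \<le> emeasure \<mu> A" "ennreal b \<le> emeasure \<mu> B" "a > 0" "b > 0"
  shows "ennreal (a powr t * b powr (1 - t)) \<le> emeasure \<mu> C"
proof -
  let ?S = "(\<lambda>x. t *\<^sub>R x) ` A + (\<lambda>x. (1 - t) *\<^sub>R x) ` B"
  have "ennreal (a powr t * b powr (1 - t)) = ennreal (a powr t) * ennreal (b powr (1 - t))"
    by (simp add: ennreal_mult')
  also have "\<dots> \<le> ennreal_powr (emeasure \<mu> A) t * ennreal_powr (emeasure \<mu> B) (1 - t)"
    using assms by (intro mult_mono ennreal_powr_ge) auto
  also have "\<dots> \<le> outer_measure_of \<mu> ?S"
    using log_concave assms(1,2,4,5) by (simp add: log_concave_measure_def)
  also have "\<dots> \<le> outer_measure_of \<mu> C" by (rule outer_measure_of_mono) (use assms in auto)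
  also have "\<dots> = emeasure \<mu> C" using assms by (intro outer_measure_of_eq) simp
  finally show ?thesis .
qed

lemma H_convex_wmix:
  assumes "finite I" "\<And>i. i \<in> I \<Longrightarrow> H_convex H (K i)" "\<And>i. i \<in> I \<Longrightarrow> d i > 0"
  shows "H_convex H (wmix I d K)"
  using assms
proof (induction I rule: finite_induct)
  case empty
  \<comment> \<open>The empty mixture is \<open>{0}\<close>.\<close>
  then show ?case using H_convex_zero by (simp add: wmix_def)
next
  case (insert i I)
  then show ?case by (auto simp: wmix_insert intro!: H_convex_plus H_convex_scaleR)
qed

text \<open>Splitting off the weight \<open>t = d i\<close> and renormalising the rest gives a
  binary mixture, and \<open>c powr t * c powr (1 - t) = c\<close>, so the level is not
  lowered.\<close>

lemma emeasure_wmix: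
  assumes "finite I" "I \<noteq> {}" "\<And>i. i \<in> I \<Longrightarrow> H_convex H (K i)" "\<And>i. i \<in> I \<Longrightarrow> d i > 0" "sum d I = 1"
    and "\<And>i. i \<in> I \<Longrightarrow> ennreal c \<le> emeasure \<mu> (K i)" "c > 0"
  shows "ennreal c \<le> emeasure \<mu> (wmix I d K)"
  using assms(1-6)
proof (induction I arbitrary: d rule: finite_ne_induct)
  case (singleton i)
  then have "wmix {i} d K = K i" by (auto simp: wmix_def)
  then show ?case using singleton by simp
next
  case (insert i I)
  define t where "t = d i"
  have sI: "sum d I = 1 - t" using insert by (simp add: t_def)
  have "sum d I > 0" using insert by (intro sum_pos) auto
  then have t: "0 < t" "t < 1" using insert sI by (auto simp: t_def)
  define e where "e j = d j / (1 - t)" for j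
  have e: "sum e I = 1" "\<And>j. j \<in> I \<Longrightarrow> e j > 0"
    using sI t insert by (auto simp: e_def sum_divide_distrib[symmetric])
  have 1: "ennreal c \<le> emeasure \<mu> (wmix I e K)" using e insert by (intro insert.IH) auto
  have 2: "(\<lambda>x. (1 - t) *\<^sub>R x) ` wmix I e K = wmix I d K"
    using t by (simp add: scaleR_image_wmix e_def)
  have H: "H_convex H (wmix (insert i I) d K)" "H_convex H (wmix I e K)"
    using insert e by (auto intro!: H_convex_wmix)
  have "K i \<in> sets borel" using insert.prems(1)[of i] H_convex_borel by auto
  then have "ennreal (c powr t * c powr (1 - t)) \<le> emeasure \<mu> (wmix (insert i I) d K)"
    using insert t 1 2 H assms(7)
    by (intro log_concave_bound[of "K i" "wmix I e K"])
      (auto simp: wmix_insert H_convex_borel t_def)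
  then show ?case using assms(7) by (simp flip: powr_add)
qed

text \<open>Support values are additive under mixtures, so the two mixtures are compared direction
  by direction. Where some \<open>K i\<close> with \<open>i \<in> I\<close> is unbounded, no
  halfspace with that normal contains the larger mixture and nothing is to be checked.\<close>

lemma wmix_subset_wmix:
  assumes "finite I" "finite J"
    and d: "\<And>i. i \<in> I \<Longrightarrow> d i > 0" "sum d I = 1" and e: "\<And>i. i \<in> J \<Longrightarrow> e i > 0"
    and K: "\<And>i. i \<in> I \<Longrightarrow> H_convex H (K i)" "\<And>i. i \<in> I \<Longrightarrow> K i \<noteq> {}"
    and cmp: "\<And>h. h \<in> H \<Longrightarrow> (\<exists>i\<in>I. \<not> bounded_in (K i) h) \<or>
      (\<forall>i\<in>I \<union> J. bounded_in (K i) h) \<and> (\<Sum>i\<in>J. e i * supp (K i) h) \<le> (\<Sum>i\<in>I. d i * supp (K i) h)"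
  shows "wmix J e K \<subseteq> wmix I d K"
proof (rule H_convex_subsetI)
  show "H_convex H (wmix I d K)" using assms by (intro H_convex_wmix) auto
next
  fix h c x assume h: "h \<in> H" and P: "wmix I d K \<subseteq> {y. y \<bullet> h \<le> c}" and x: "x \<in> wmix J e K"
  have bd: "bounded_in (K i) h" if i: "i \<in> I" for i
  proof (rule ccontr)
    assume "\<not> bounded_in (K i) h"
    then obtain y where "y \<in> wmix I d K" "y \<bullet> h \<ge> c + 1"
      using wmix_unbounded[of I d K i h "c + 1"] assms i by auto
    then show False using P by auto
  qed
  then have cmp': "\<forall>i\<in>J. bounded_in (K i) h"
      "(\<Sum>i\<in>J. e i * supp (K i) h) \<le> (\<Sum>i\<in>I. d i * supp (K i) h)"
    using cmp[OF h] by auto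
  have "x \<bullet> h \<le> (\<Sum>i\<in>J. e i * supp (K i) h)"
    using x e cmp'(1) by (intro wmix_inner_le[of x J e K]) (auto intro: less_imp_le supp_upper)
  also note cmp'(2)
  \<comment> \<open>Suprema need not be attained, so each is approximated within \<epsilon>; as the
    weights sum to one, the total error is \<epsilon>.\<close>
  also have "(\<Sum>i\<in>I. d i * supp (K i) h) \<le> c"
  proof (rule field_le_epsilon)
    fix \<epsilon> :: real assume "\<epsilon> > 0"
    then have "\<exists>y\<in>K i. y \<bullet> h \<ge> supp (K i) h - \<epsilon>" if "i \<in> I" for i
      using supp_approx[OF bd[OF that] K(2)[OF that]] by blast
    then obtain y where y: "y \<in> wmix I d K" "y \<bullet> h \<ge> (\<Sum>i\<in>I. d i * (supp (K i) h - \<epsilon>))"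
      using wmix_inner_ge[of I d K "\<lambda>i. supp (K i) h - \<epsilon>" h] d by (meson less_imp_le)
    have "(\<Sum>i\<in>I. d i * (supp (K i) h - \<epsilon>)) = (\<Sum>i\<in>I. d i * supp (K i) h) - \<epsilon>"
      using d(2) by (simp add: right_diff_distrib sum_subtractf flip: sum_distrib_right)
    then show "(\<Sum>i\<in>I. d i * supp (K i) h) \<le> c + \<epsilon>" using y P by auto
  qed
  finally show "x \<bullet> h \<le> c" .
qed

text \<open>Only \<open>K i\<close> may leave the member \<open>i\<close> of \<F>. A member outside
  \<open>J\<close> contains the mixture over \<open>J\<close> directly; a member in \<open>J\<close>
  is outside \<open>I\<close>, so it contains the larger mixture over \<open>I\<close> and hence the
  one over \<open>J\<close>.\<close>

lemma comparable_mixtures: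
  assumes conv: "\<And>F. F \<in> \<F> \<Longrightarrow> convex F" and c: "c > 0" and T: "finite T"
    and K: "\<And>i. i \<in> T \<Longrightarrow> H_convex H (K i)" "\<And>i. i \<in> T \<Longrightarrow> K i \<subseteq> \<Inter>(\<F> - {i})"
      "\<And>i. i \<in> T \<Longrightarrow> ennreal c \<le> emeasure \<mu> (K i)"
    and IJ: "I \<subseteq> T" "J \<subseteq> T" "I \<inter> J = {}" "J \<noteq> {}"
    and d: "\<forall>i\<in>I. d i > 0" "sum d I = 1" and e: "\<forall>i\<in>J. e i > 0" "sum e J = 1"
    and cmp: "\<And>h. h \<in> H \<Longrightarrow> (\<exists>i\<in>I. \<not> bounded_in (K i) h) \<or>
      (\<forall>i\<in>I \<union> J. bounded_in (K i) h) \<and> (\<Sum>i\<in>J. e i * supp (K i) h) \<le> (\<Sum>i\<in>I. d i * supp (K i) h)"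
  shows "\<exists>P. H_convex H P \<and> P \<subseteq> \<Inter>\<F> \<and> ennreal c \<le> emeasure \<mu> P"
proof (intro exI conjI)
  have fin: "finite I" "finite J" using IJ T by (auto intro: finite_subset)
  have KI: "H_convex H (K i)" "K i \<noteq> {}" if "i \<in> I" for i using K(1,3)[of i] that c IJ by auto
  have KJ: "H_convex H (K i)" "ennreal c \<le> emeasure \<mu> (K i)" if "i \<in> J" for i using K(1,3)[of i] that IJ by auto
  have sub: "wmix J e K \<subseteq> wmix I d K"
    by (rule wmix_subset_wmix[OF fin bspec[OF d(1)] d(2) bspec[OF e(1)] KI cmp])
  show "H_convex H (wmix J e K)" using fin e KJ by (intro H_convex_wmix) auto
  show "ennreal c \<le> emeasure \<mu> (wmix J e K)" using fin e KJ c IJ by (intro emeasure_wmix) auto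
  show "wmix J e K \<subseteq> \<Inter>\<F>"
  proof (intro Inter_greatest)
    fix F assume F: "F \<in> \<F>"
    show "wmix J e K \<subseteq> F"
    proof (cases "F \<in> J")
      case False
      then have "K i \<subseteq> F" if "i \<in> J" for i using K(2)[of i] that F IJ by auto
      then show ?thesis using F conv fin e by (intro wmix_subset_convex) (auto intro: less_imp_le)
    next
      case True
      then have "F \<notin> I" using IJ by auto
      then have "K i \<subseteq> F" if "i \<in> I" for i using K(2)[of i] that F IJ by auto
      then have "wmix I d K \<subseteq> F"
        using F conv fin d by (intro wmix_subset_convex) (auto intro: less_imp_le)
      then show ?thesis using sub by simp
    qed
  qed
qed

text \<open>The support values of the two Radon mixtures differ by the same \<open>s \<ge> 0\<close>
  in all directions of \<open>H\<close>, so the one over \<open>J\<close> lies in the other. The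
  level \<open>c\<close> stays free because truncated sets may only reach levels below one.\<close>

lemma bounded_case:
  assumes "\<And>F. F \<in> \<F> \<Longrightarrow> convex F" "c > 0"
    and "finite T" "card H < card T"
    and "\<And>i. i \<in> T \<Longrightarrow> H_convex H (K i)" "\<And>i. i \<in> T \<Longrightarrow> K i \<subseteq> \<Inter>(\<F> - {i})"
      "\<And>i. i \<in> T \<Longrightarrow> ennreal c \<le> emeasure \<mu> (K i)"
      "\<And>i h. i \<in> T \<Longrightarrow> h \<in> H \<Longrightarrow> bounded_in (K i) h"
  shows "\<exists>P. H_convex H P \<and> P \<subseteq> \<Inter>\<F> \<and> ennreal c \<le> emeasure \<mu> P"
proof -
  have "H \<noteq> {}" using card_H by auto
  then obtain I J s d e where *: "I \<subseteq> T" "J \<subseteq> T" "I \<inter> J = {}" "I \<noteq> {}" "J \<noteq> {}" "s \<ge> 0"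
    "\<forall>i\<in>I. d i > 0" "\<forall>i\<in>J. e i > 0" "sum d I = (1::real)" "sum e J = (1::real)"
    "\<forall>h\<in>H. (\<Sum>i\<in>I. d i * supp (K i) h) = (\<Sum>i\<in>J. e i * supp (K i) h) + s"
    by (rule radon_modulo_constants[OF assms(3) finite_H _ assms(4), of "\<lambda>i h. supp (K i) h"])
  show ?thesis
  proof (rule comparable_mixtures[OF assms(1,2,3,5,6,7) *(1,2,3,5,7,9,8,10)])
    fix h assume h: "h \<in> H"
    have "\<forall>i\<in>I \<union> J. bounded_in (K i) h" using assms(8) h *(1,2) by blast
    then show "(\<exists>i\<in>I. \<not> bounded_in (K i) h) \<or> (\<forall>i\<in>I \<union> J. bounded_in (K i) h) \<and>
        (\<Sum>i\<in>J. e i * supp (K i) h) \<le> (\<Sum>i\<in>I. d i * supp (K i) h)"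
      using *(6,11) h by simp
  qed
qed

text \<open>
  The direction $g$ is dropped from the Radon relation, which frees the index $u$. If the relation
  leaves a positive slack, a small share of $K_u$ makes the larger mixture infinite on $Z$; if it is
  an equality, then either some set unbounded on $Z$ occurs in it, or only $g$ is left to compare.
\<close>

lemma common_unbounded_case:
  assumes "\<And>F. F \<in> \<F> \<Longrightarrow> convex F" "c > 0"
    and T: "finite T" "card H \<le> card T" "u \<notin> T"
    and K: "\<And>i. i \<in> insert u T \<Longrightarrow> H_convex H (K i)"
      "\<And>i. i \<in> insert u T \<Longrightarrow> K i \<subseteq> \<Inter>(\<F> - {i})"
      "\<And>i. i \<in> insert u T \<Longrightarrow> ennreal c \<le> emeasure \<mu> (K i)"
    and Z: "g \<in> Z" "Z \<subseteq> H"
    and u: "\<And>h. h \<in> H \<Longrightarrow> bounded_in (K u) h \<longleftrightarrow> h \<notin> Z"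
    and pattern: "\<And>i. i \<in> T \<Longrightarrow> (\<forall>h\<in>H. bounded_in (K i) h) \<or> (\<forall>h\<in>H. bounded_in (K i) h \<longleftrightarrow> h \<notin> Z)"
  shows "\<exists>P. H_convex H P \<and> P \<subseteq> \<Inter>\<F> \<and> ennreal c \<le> emeasure \<mu> P"
proof -
  define E where "E = H - {g}"
  have gH: "g \<in> H" using Z by auto
  have cE: "card E = card H - 1" using finite_H gH by (simp add: E_def)
  then have E: "finite E" "card E < card T" "E \<noteq> {}"
    using finite_H card_H T by (simp add: E_def) (use cE card_H T in auto)
  \<comment> \<open>In directions of \<open>Z\<close> these values may be meaningless; they enter a
    comparison there only when all sets of both mixtures are bounded.\<close>
  let ?a = "\<lambda>i h. supp (K i) h"
  obtain I J s d e where *: "I \<subseteq> T" "J \<subseteq> T" "I \<inter> J = {}" "I \<noteq> {}" "J \<noteq> {}" "s \<ge> 0"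
    "\<forall>i\<in>I. d i > 0" "\<forall>i\<in>J. e i > 0" "sum d I = (1::real)" "sum e J = (1::real)"
    "\<forall>h\<in>E. (\<Sum>i\<in>I. d i * ?a i h) = (\<Sum>i\<in>J. e i * ?a i h) + s"
    by (rule radon_modulo_constants[OF T(1) E(1,3,2), of ?a])
  have fin: "finite I" "finite J" using * T finite_subset by auto
  have offZ: "bounded_in (K i) h" if "i \<in> insert u T" "h \<in> H" "h \<notin> Z" for i h
    using that u[of h] pattern[of i] by auto
  define unb where "unb i \<longleftrightarrow> (\<forall>h\<in>Z. \<not> bounded_in (K i) h)" for i
  have pat: "unb i \<or> (\<forall>h\<in>H. bounded_in (K i) h)" if "i \<in> T" for i
    using pattern[OF that] Z(2) by (auto simp: unb_def)
  have K': "\<And>i. i \<in> T \<Longrightarrow> H_convex H (K i)" "\<And>i. i \<in> T \<Longrightarrow> K i \<subseteq> \<Inter>(\<F> - {i})"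
      "\<And>i. i \<in> T \<Longrightarrow> ennreal c \<le> emeasure \<mu> (K i)"
    using K by simp_all
  show ?thesis
  proof (cases "s = 0")
    case True
    have eq: "(\<Sum>i\<in>I. d i * ?a i h) = (\<Sum>i\<in>J. e i * ?a i h)" if "h \<in> H" "h \<noteq> g" for h
      using * True that by (auto simp: E_def)
    have IJ: ?thesis if "\<And>h. h \<in> H \<Longrightarrow> (\<exists>i\<in>I. \<not> bounded_in (K i) h) \<or>
        (\<forall>i\<in>I \<union> J. bounded_in (K i) h) \<and> (\<Sum>i\<in>J. e i * ?a i h) \<le> (\<Sum>i\<in>I. d i * ?a i h)"
      by (rule comparable_mixtures[OF assms(1,2) T(1) K' *(1,2,3,5,7,9,8,10) that])
    \<comment> \<open>With \<open>s = 0\<close> the relation is symmetric, so either mixture may be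
      taken as the larger one.\<close>
    have JI: ?thesis if "\<And>h. h \<in> H \<Longrightarrow> (\<exists>i\<in>J. \<not> bounded_in (K i) h) \<or>
        (\<forall>i\<in>J \<union> I. bounded_in (K i) h) \<and> (\<Sum>i\<in>I. d i * ?a i h) \<le> (\<Sum>i\<in>J. e i * ?a i h)"
    proof (rule comparable_mixtures[OF assms(1,2) T(1) K' *(2,1) _ *(4,8,10,7,9) that])
      show "J \<inter> I = {}" using *(3) by blast
    qed
    show ?thesis
    proof (cases "\<exists>i\<in>I \<union> J. unb i")
      case True
      have off: "(\<forall>i\<in>I \<union> J. bounded_in (K i) h) \<and> (\<Sum>i\<in>I. d i * ?a i h) = (\<Sum>i\<in>J. e i * ?a i h)"
        if "h \<in> H" "h \<notin> Z" for h
      proof -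
        have "h \<noteq> g" using that Z(1) by auto
        then show ?thesis using eq[OF that(1)] offZ that *(1,2) by blast
      qed
      from True consider i where "i \<in> I" "unb i" | i where "i \<in> J" "unb i" by auto
      then show ?thesis
      proof cases
        case 1
        have *: "\<exists>i\<in>I. \<not> bounded_in (K i) h" if "h \<in> Z" for h using 1 that by (auto simp: unb_def)
        show ?thesis
        proof (rule IJ)
          fix h assume "h \<in> H"
          then show "(\<exists>i\<in>I. \<not> bounded_in (K i) h) \<or> (\<forall>i\<in>I \<union> J. bounded_in (K i) h) \<and>
              (\<Sum>i\<in>J. e i * ?a i h) \<le> (\<Sum>i\<in>I. d i * ?a i h)"
            using *[of h] off[of h] by (cases "h \<in> Z") simp_all
        qed
      next
        case 2
        have *: "\<exists>i\<in>J. \<not> bounded_in (K i) h" if "h \<in> Z" for h using 2 that by (auto simp: unb_def)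
        show ?thesis
        proof (rule JI)
          fix h assume "h \<in> H"
          then show "(\<exists>i\<in>J. \<not> bounded_in (K i) h) \<or> (\<forall>i\<in>J \<union> I. bounded_in (K i) h) \<and>
              (\<Sum>i\<in>I. d i * ?a i h) \<le> (\<Sum>i\<in>J. e i * ?a i h)"
            using *[of h] off[of h] by (cases "h \<in> Z") (simp_all add: Un_commute)
        qed
      qed
    next
      case False
      then have bd: "\<forall>i\<in>I \<union> J. bounded_in (K i) h" if "h \<in> H" for h
        using pat *(1,2) that by (meson UnE subsetD)
      show ?thesis
      proof (cases "(\<Sum>i\<in>J. e i * ?a i g) \<le> (\<Sum>i\<in>I. d i * ?a i g)")
        case True
        then have "(\<Sum>i\<in>J. e i * ?a i h) \<le> (\<Sum>i\<in>I. d i * ?a i h)" if "h \<in> H" for h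
          using eq[of h] that by (cases "h = g") auto
        with bd show ?thesis by (intro IJ disjI2 conjI)
      next
        case False
        then have "(\<Sum>i\<in>I. d i * ?a i h) \<le> (\<Sum>i\<in>J. e i * ?a i h)" if "h \<in> H" for h
          using eq[of h] that by (cases "h = g") auto
        with bd show ?thesis by (intro JI disjI2 conjI) (simp_all add: Un_commute)
      qed
    qed
  next
    case False
    then have s: "s > 0" using * by simp
    define gap where "gap h = \<bar>(\<Sum>i\<in>I. d i * ?a i h) - ?a u h\<bar>" for h
    define M where "M = sum gap H"
    have gap: "gap h \<le> M" if "h \<in> H" for h
      unfolding M_def using finite_H that by (intro member_le_sum) (auto simp: gap_def)
    have M: "M \<ge> 0" unfolding M_def by (intro sum_nonneg) (auto simp: gap_def)
    \<comment> \<open>A share \<epsilon> of \<open>K u\<close> changes the support value in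
      direction \<open>h\<close> by at most \<open>\<epsilon> * gap h\<close>. Since
      \<open>M\<close> bounds every gap, this choice keeps the loss within the slack
      \<open>s\<close>.\<close>
    define \<epsilon> where "\<epsilon> = s / (s + M + 1)"
    have \<epsilon>: "0 < \<epsilon>" "\<epsilon> < 1" using s M by (auto simp: \<epsilon>_def field_simps)
    have \<epsilon>gap: "\<epsilon> * gap h \<le> s" if "h \<in> H" for h
    proof -
      have "\<epsilon> * gap h \<le> \<epsilon> * (s + M + 1)" using gap[OF that] s \<epsilon> by (intro mult_left_mono) auto
      also have "\<dots> = s" using s M by (simp add: \<epsilon>_def)
      finally show ?thesis .
    qed
    define d' where "d' i = (if i = u then \<epsilon> else (1 - \<epsilon>) * d i)" for i
    have uI: "u \<notin> I" "u \<notin> J" using * T by auto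
    have d'I: "(\<Sum>i\<in>I. d' i * f i) = (1 - \<epsilon>) * (\<Sum>i\<in>I. d i * f i)" for f :: "'a set \<Rightarrow> real"
      unfolding sum_distrib_left using uI by (intro sum.cong) (auto simp: d'_def)
    have d'sum: "(\<Sum>i\<in>insert u I. d' i * f i) = \<epsilon> * f u + (1 - \<epsilon>) * (\<Sum>i\<in>I. d i * f i)" for f
      using fin uI d'I by (simp add: d'_def)
    show ?thesis
    proof (rule comparable_mixtures[OF assms(1,2) _ K _ _ _ *(5) _ _ *(8,10)])
      show "finite (insert u T)" using T(1) by simp
      show "insert u I \<subseteq> insert u T" "J \<subseteq> insert u T" "insert u I \<inter> J = {}" using *(1,2,3) uI by auto
      show "sum d' (insert u I) = 1" using d'sum[of "\<lambda>_. 1"] *(9) by simp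
      show "\<forall>i\<in>insert u I. 0 < d' i" using *(7) \<epsilon> by (auto simp: d'_def)
      fix h assume h: "h \<in> H"
      show "(\<exists>i\<in>insert u I. \<not> bounded_in (K i) h) \<or> (\<forall>i\<in>insert u I \<union> J. bounded_in (K i) h) \<and>
           (\<Sum>i\<in>J. e i * ?a i h) \<le> (\<Sum>i\<in>insert u I. d' i * ?a i h)"
      proof (cases "h \<in> Z")
        case True
        then show ?thesis using u[of h] h by simp
      next
        case False
        then have hg: "h \<noteq> g" using Z(1) by auto
        have "(\<Sum>i\<in>insert u I. d' i * ?a i h)
            = (\<Sum>i\<in>I. d i * ?a i h) - \<epsilon> * ((\<Sum>i\<in>I. d i * ?a i h) - ?a u h)"
          by (simp only: d'sum) (simp add: algebra_simps)
        moreover have "\<epsilon> * ((\<Sum>i\<in>I. d i * ?a i h) - ?a u h) \<le> \<epsilon> * gap h"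
          using \<epsilon> by (intro mult_left_mono) (auto simp: gap_def)
        moreover have "(\<Sum>i\<in>I. d i * ?a i h) = (\<Sum>i\<in>J. e i * ?a i h) + s"
          using * h hg by (auto simp: E_def)
        ultimately have "(\<Sum>i\<in>J. e i * ?a i h) \<le> (\<Sum>i\<in>insert u I. d' i * ?a i h)"
          using \<epsilon>gap[OF h] by linarith
        moreover have "\<forall>i\<in>insert u I \<union> J. bounded_in (K i) h" using offZ *(1,2) h False by blast
        ultimately show ?thesis by blast
      qed
    qed
  qed
qed

section \<open>Quantiles and unbounded directions\<close>

text \<open>The quantile is the supremum of the levels whose open upper tail has measure at least
  \<theta>. Continuity of the measure along monotone sequences leads to the open tail from above and
  to the closed tail from below; mass on the hyperplane counts on both sides.\<close>

lemma quantile_exists: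
  assumes K: "K \<in> sets borel" "emeasure \<mu> K = ennreal m" and \<theta>: "0 < \<theta>" "\<theta> < m"
  shows "\<exists>x. ennreal \<theta> \<le> emeasure \<mu> (K \<inter> {y. y \<bullet> h \<ge> x})
    \<and> ennreal (m - \<theta>) \<le> emeasure \<mu> (K \<inter> {y. y \<bullet> h \<le> x})"
proof -
  define \<phi> where "\<phi> x = measure \<mu> (K \<inter> {y. y \<bullet> h > x})" for x
  have fin: "emeasure \<mu> (K \<inter> A) \<noteq> \<infinity>" for A
    using emeasure_mono[of "K \<inter> A" K \<mu>] K by (auto simp: top_unique)
  have em: "emeasure \<mu> (K \<inter> A) = ennreal (measure \<mu> (K \<inter> A))" for A
    using fin by (intro emeasure_eq_ennreal_measure) auto
  have mono: "measure \<mu> (K \<inter> A) \<le> measure \<mu> (K \<inter> B)" if "A \<subseteq> B" "A \<in> sets borel" "B \<in> sets borel" for A B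
    using that K fin by (intro measure_mono_fmeasurable) (auto simp: fmeasurable_def less_top)
  have up: "(\<lambda>n. measure \<mu> (K \<inter> A n)) \<longlonglongrightarrow> measure \<mu> (K \<inter> (\<Union>n. A n))"
    if "incseq A" "\<And>n. A n \<in> sets borel" for A :: "nat \<Rightarrow> 'a set"
  proof -
    have "(\<lambda>n. measure \<mu> (K \<inter> A n)) \<longlonglongrightarrow> measure \<mu> (\<Union>n. K \<inter> A n)"
      using that K fin[of "\<Union>n. A n"] by (intro Lim_measure_incseq) (auto simp: incseq_def)
    then show ?thesis by simp
  qed
  have down: "(\<lambda>n. measure \<mu> (K \<inter> A n)) \<longlonglongrightarrow> measure \<mu> (K \<inter> (\<Inter>n. A n))"
    if "decseq A" "\<And>n. A n \<in> sets borel" for A :: "nat \<Rightarrow> 'a set"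
  proof -
    have "(\<lambda>n. measure \<mu> (K \<inter> A n)) \<longlonglongrightarrow> measure \<mu> (\<Inter>n. K \<inter> A n)"
      using that K fin by (intro Lim_measure_decseq) (auto simp: decseq_def)
    then show ?thesis by simp
  qed
  have \<phi>_mono: "\<phi> y \<le> \<phi> x" if "x \<le> y" for x y
    unfolding \<phi>_def using that by (intro mono) auto
  have inc: "incseq (\<lambda>n. {y. y \<bullet> h > s n})" if "decseq s" for s :: "nat \<Rightarrow> real"
    using that by (auto simp: incseq_def decseq_def intro: le_less_trans)
  have dec: "decseq (\<lambda>n. {y. y \<bullet> h > s n})" if "incseq s" for s :: "nat \<Rightarrow> real"
    using that by (auto simp: incseq_def decseq_def intro: le_less_trans)
  \<comment> \<open>The tails tend to \<open>m\<close> and to 0 at the two ends, so \<open>S\<close>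
    below is nonempty because \<theta> < m and bounded above because \<theta> > 0.\<close>
  have mK: "measure \<mu> K = m" using K \<theta> by (simp add: measure_def)
  define S where "S = {x. \<phi> x \<ge> \<theta>}"
  have "S \<noteq> {}"
  proof -
    have "(\<Union>n. {y. y \<bullet> h > - real n}) = UNIV"
      by (auto) (metis add.inverse_inverse neg_less_iff_less reals_Archimedean2)
    then have "(\<lambda>n. \<phi> (- real n)) \<longlonglongrightarrow> m"
      using up[OF inc[of "\<lambda>n. - real n"]] mK by (simp add: \<phi>_def decseq_def)
    then have "eventually (\<lambda>n. \<phi> (- real n) > \<theta>) sequentially" using \<theta> by (intro order_tendstoD) auto
    then obtain n where "\<phi> (- real n) > \<theta>" by (auto simp: eventually_sequentially)
    then show ?thesis by (auto simp: S_def intro: less_imp_le)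
  qed
  moreover have "bdd_above S"
  proof -
    have "(\<Inter>n. {y. y \<bullet> h > real n}) = {}"
      by (auto) (metis less_imp_le not_less reals_Archimedean2)
    then have "(\<lambda>n. \<phi> (real n)) \<longlonglongrightarrow> 0"
      using down[OF dec[of real]] by (simp add: \<phi>_def incseq_def)
    then have "eventually (\<lambda>n. \<phi> (real n) < \<theta>) sequentially" using \<theta> by (intro order_tendstoD) auto
    then obtain n where n: "\<phi> (real n) < \<theta>" by (auto simp: eventually_sequentially)
    have "x \<le> real n" if "x \<in> S" for x
      using that n \<phi>_mono[of "real n" x] by (force simp: S_def)
    then show ?thesis by (auto simp: bdd_above_def)
  qed
  ultimately have less_Sup: "\<And>y. y < Sup S \<longleftrightarrow> (\<exists>x\<in>S. y < x)" using less_cSup_iff by blast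
  define x where "x = Sup S"
  have above: "\<phi> z \<le> \<theta>" if "z > x" for z
  proof (rule ccontr)
    assume "\<not> \<phi> z \<le> \<theta>"
    then have "z \<in> S" by (simp add: S_def)
    then have "z \<le> x" unfolding x_def using \<open>bdd_above S\<close> by (intro cSup_upper)
    then show False using that by simp
  qed
  have below: "\<phi> z \<ge> \<theta>" if z: "z < x" for z
  proof -
    obtain z' where "z' \<in> S" "z < z'" using less_Sup z by (auto simp: x_def)
    then show ?thesis using \<phi>_mono[of z z'] by (auto simp: S_def)
  qed
  \<comment> \<open>Levels decreasing to \<open>x\<close>: their open tails exhaust the open tail at
    \<open>x\<close>, whose measure is therefore at most \<theta>.\<close>
  have "(\<Union>n. {y. y \<bullet> h > x + inverse (real (Suc n))}) = {y. y \<bullet> h > x}"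
  proof -
    have "\<exists>n. y \<bullet> h > x + inverse (real (Suc n))" if "y \<bullet> h > x" for y
      using reals_Archimedean[of "y \<bullet> h - x"] that by (auto simp: algebra_simps)
    moreover have "y \<bullet> h > x" if "y \<bullet> h > x + inverse (real (Suc n))" for y n
      using that positive_imp_inverse_positive[of "real (Suc n)"] by linarith
    ultimately show ?thesis by blast
  qed
  then have lim1: "(\<lambda>n. \<phi> (x + inverse (real (Suc n)))) \<longlonglongrightarrow> \<phi> x"
    using up[OF inc[of "\<lambda>n. x + inverse (real (Suc n))"]]
    by (simp add: \<phi>_def decseq_def le_imp_inverse_le)
  have 1: "\<phi> x \<le> \<theta>"
    by (rule LIMSEQ_le_const2[OF lim1]) (auto intro!: above exI[of _ 0])
  \<comment> \<open>Levels increasing to \<open>x\<close>: their open tails shrink to the closed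
    tail at \<open>x\<close>, which keeps measure at least \<theta>.\<close>
  have "(\<Inter>n. {y. y \<bullet> h > x - inverse (real (Suc n))}) = {y. y \<bullet> h \<ge> x}"
  proof -
    have "y \<bullet> h \<ge> x" if "\<forall>n. y \<bullet> h > x - inverse (real (Suc n))" for y
      using reals_Archimedean[of "x - y \<bullet> h"] that by (smt (verit))
    moreover have "y \<bullet> h > x - inverse (real (Suc n))" if "y \<bullet> h \<ge> x" for y n
      using that positive_imp_inverse_positive[of "real (Suc n)"] by linarith
    ultimately show ?thesis by blast
  qed
  then have lim2: "(\<lambda>n. \<phi> (x - inverse (real (Suc n)))) \<longlonglongrightarrow> measure \<mu> (K \<inter> {y. y \<bullet> h \<ge> x})"
    using down[OF dec[of "\<lambda>n. x - inverse (real (Suc n))"]]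
    by (simp add: \<phi>_def incseq_def le_imp_inverse_le)
  have 2: "measure \<mu> (K \<inter> {y. y \<bullet> h \<ge> x}) \<ge> \<theta>"
    by (rule LIMSEQ_le_const[OF lim2]) (auto intro!: below exI[of _ 0])
  have "measure \<mu> (K \<inter> {y. y \<bullet> h \<le> x} \<union> K \<inter> {y. y \<bullet> h > x}) = measure \<mu> (K \<inter> {y. y \<bullet> h \<le> x}) + \<phi> x"
    unfolding \<phi>_def using K fin by (intro measure_Union) auto
  moreover have "K \<inter> {y. y \<bullet> h \<le> x} \<union> K \<inter> {y. y \<bullet> h > x} = K" by auto
  ultimately have 3: "measure \<mu> (K \<inter> {y. y \<bullet> h \<le> x}) \<ge> m - \<theta>" using 1 mK by simp
  show ?thesis using 2 3 em by (auto intro!: exI[of _ x] ennreal_leI)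
qed

section \<open>Comparison of quantiles through midsets\<close>

definition midset :: "'a set \<Rightarrow> 'a set \<Rightarrow> 'a set" where
  "midset K Q = (\<lambda>x. (1/2) *\<^sub>R x) ` K + (\<lambda>x. (1/2) *\<^sub>R x) ` Q"

lemma H_convex_midset: "H_convex H K \<Longrightarrow> H_convex H Q \<Longrightarrow> H_convex H (midset K Q)"
  unfolding midset_def by (intro H_convex_plus H_convex_scaleR) auto

lemma midset_subset_convex: "convex F \<Longrightarrow> K \<subseteq> F \<Longrightarrow> Q \<subseteq> F \<Longrightarrow> midset K Q \<subseteq> F"
  by (auto simp: midset_def set_plus_def intro!: convexD)

text \<open>If the inequality failed, the midpoints of the two upper tails and those of the two
  lower tails would lie in disjoint parts of the midset. By log-concavity these have measure at
  least \<open>sqrt a' * sqrt b'\<close> and \<open>sqrt a * sqrt b\<close>, more than one in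
  total.\<close>

lemma tail_comparison:
  assumes K: "H_convex H K" "H_convex H Q" and le: "emeasure \<mu> (midset K Q) \<le> 1"
    and upper: "ennreal a' \<le> emeasure \<mu> (K \<inter> {y. y \<bullet> h \<ge> x'})"
      "ennreal b' \<le> emeasure \<mu> (Q \<inter> {y. y \<bullet> h \<ge> y'})"
    and lower: "ennreal a \<le> emeasure \<mu> (K \<inter> {y. y \<bullet> h \<le> x})"
      "ennreal b \<le> emeasure \<mu> (Q \<inter> {z. z \<bullet> h \<le> y})"
    and pos: "a > 0" "b > 0" "a' > 0" "b' > 0"
    and gt1: "sqrt a' * sqrt b' + sqrt a * sqrt b > 1"
  shows "x' + y' \<le> x + y"
proof (rule ccontr)
  assume "\<not> x' + y' \<le> x + y"
  then have xy: "(x + y) / 2 < (x' + y') / 2" by simp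
  let ?M = "midset K Q"
  let ?U = "?M \<inter> {z. z \<bullet> h \<ge> (x' + y') / 2}" and ?L = "?M \<inter> {z. z \<bullet> h \<le> (x + y) / 2}"
  have M: "?M \<in> sets borel" "K \<in> sets borel" "Q \<in> sets borel"
    using K H_convex_midset H_convex_borel by auto
  have "ennreal (a' powr (1/2) * b' powr (1 - 1/2)) \<le> emeasure \<mu> ?U"
    using M pos upper
    by (intro log_concave_bound[of "K \<inter> {y. y \<bullet> h \<ge> x'}" "Q \<inter> {y. y \<bullet> h \<ge> y'}"])
      (auto simp: midset_def set_plus_def inner_add_left field_simps)
  then have U: "ennreal (sqrt a' * sqrt b') \<le> emeasure \<mu> ?U" using pos by (simp add: powr_half_sqrt)
  have "ennreal (a powr (1/2) * b powr (1 - 1/2)) \<le> emeasure \<mu> ?L"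
    using M pos lower
    by (intro log_concave_bound[of "K \<inter> {y. y \<bullet> h \<le> x}" "Q \<inter> {z. z \<bullet> h \<le> y}"])
      (auto simp: midset_def set_plus_def inner_add_left field_simps)
  then have L: "ennreal (sqrt a * sqrt b) \<le> emeasure \<mu> ?L" using pos by (simp add: powr_half_sqrt)
  have "ennreal 1 < ennreal (sqrt a' * sqrt b' + sqrt a * sqrt b)"
    using gt1 pos by (subst ennreal_less_iff) auto
  also have "\<dots> = ennreal (sqrt a' * sqrt b') + ennreal (sqrt a * sqrt b)"
    using pos by (intro ennreal_plus) auto
  also have "\<dots> \<le> emeasure \<mu> ?U + emeasure \<mu> ?L" using U L by (rule add_mono)
  also have "\<dots> = emeasure \<mu> (?U \<union> ?L)" using M xy by (intro plus_emeasure) auto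
  also have "\<dots> \<le> emeasure \<mu> ?M" using M by (intro emeasure_mono) auto
  finally show False using le by simp
qed

lemma quantile_sequence:
  assumes "H_convex H K" "emeasure \<mu> K = ennreal m" "m > 1/2"
  shows "\<exists>x. \<forall>k. ennreal (1 / real (k + 2)) \<le> emeasure \<mu> (K \<inter> {y. y \<bullet> h \<ge> x k})
    \<and> ennreal (m - 1 / real (k + 2)) \<le> emeasure \<mu> (K \<inter> {y. y \<bullet> h \<le> x k})"
proof (intro choice allI)
  fix k :: nat
  \<comment> \<open>The largest level is 1/2, so \<open>m > 1/2\<close> puts all levels below the
    total mass.\<close>
  have "1 / real (k + 2) \<le> 1 / 2" by (simp add: field_simps)
  then have lt: "1 / real (k + 2) < m" using assms(3) by linarith
  show "\<exists>x. ennreal (1 / real (k + 2)) \<le> emeasure \<mu> (K \<inter> {y. y \<bullet> h \<ge> x})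
      \<and> ennreal (m - 1 / real (k + 2)) \<le> emeasure \<mu> (K \<inter> {y. y \<bullet> h \<le> x})"
    by (rule quantile_exists[OF H_convex_borel[OF assms(1)] assms(2) _ lt]) simp
qed

text \<open>
  Let $x_k$, $y_k$, $w_k$ be the upper quantiles of $K$, $Q$, $L$ along $h$ at level $1/(k+2)$.
  Because the levels are strictly log-convex and the midsets have measure at most one,
  $x_{k+2} - x_{k+1} \le y_{k+1} - y_k$ and $y_{k+2} - y_{k+1} \le w_{k+1} - w_k$. Hence the
  quantiles of $L$ grow at least as fast as those of $K$.
\<close>

lemma unbounded_transfer:
  assumes K: "H_convex H K" "emeasure \<mu> K = 1" "\<And>r. emeasure \<mu> (K \<inter> {y. y \<bullet> h > r}) > 0"
    and L: "H_convex H L" "emeasure \<mu> L = 1"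
    and Q: "\<And>c. 0 < c \<Longrightarrow> c < 1 \<Longrightarrow> \<exists>Q. H_convex H Q \<and> ennreal c \<le> emeasure \<mu> Q \<and> emeasure \<mu> Q \<le> 1
      \<and> emeasure \<mu> (midset K Q) \<le> 1 \<and> emeasure \<mu> (midset L Q) \<le> 1"
  shows "\<not> bounded_in L h"
proof
  assume "bounded_in L h"
  then obtain B where B: "\<And>y. y \<in> L \<Longrightarrow> y \<bullet> h \<le> B" by (auto simp: bounded_in_def bdd_above_def)
  obtain x where x: "\<And>k. ennreal (1 / real (k + 2)) \<le> emeasure \<mu> (K \<inter> {y. y \<bullet> h \<ge> x k})"
      "\<And>k. ennreal (1 - 1 / real (k + 2)) \<le> emeasure \<mu> (K \<inter> {y. y \<bullet> h \<le> x k})"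
    using quantile_sequence[of K 1 h] K by auto
  obtain w where w: "\<And>k. ennreal (1 / real (k + 2)) \<le> emeasure \<mu> (L \<inter> {y. y \<bullet> h \<ge> w k})"
      "\<And>k. ennreal (1 - 1 / real (k + 2)) \<le> emeasure \<mu> (L \<inter> {y. y \<bullet> h \<le> w k})"
    using quantile_sequence[of L 1 h] L by auto
  have wB: "w k \<le> B" for k
  proof (rule ccontr)
    assume "\<not> w k \<le> B"
    then have "L \<inter> {y. y \<bullet> h \<ge> w k} = {}" using B by force
    then show False using w(1)[of k] by simp
  qed
  \<comment> \<open>Some mass \<open>a\<close> of \<open>K\<close> lies beyond \<open>r\<close>;
    once the level 1/(n + 4) is below \<open>a\<close>, the part of \<open>K\<close> up to the
    quantile has more mass than the part up to \<open>r\<close>.\<close>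
  have "\<exists>n. x (n + 2) > r" for r
  proof -
    have KB: "K \<in> sets borel" using K(1) by (rule H_convex_borel)
    let ?A = "K \<inter> {y. y \<bullet> h > r}" and ?A' = "K \<inter> {y. y \<bullet> h \<le> r}"
    have "emeasure \<mu> ?A \<le> emeasure \<mu> K" using KB by (intro emeasure_mono) auto
    then obtain a where a: "emeasure \<mu> ?A = ennreal a" "a \<ge> 0"
      using K(2) by (cases "emeasure \<mu> ?A") (auto simp: top_unique)
    then have a0: "a > 0" using K(3)[of r] by (simp add: less_le)
    then obtain n where n: "1 / real (n + 2 + 2) < a"
    proof -
      obtain n where "inverse (real (Suc n)) < a" using reals_Archimedean a0 by blast
      moreover have "1 / real (n + 2 + 2) \<le> inverse (real (Suc n))" by (simp add: field_simps)
      ultimately show ?thesis by (intro that[of n]) linarith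
    qed
    have "x (n + 2) > r"
    proof (rule ccontr)
      assume "\<not> x (n + 2) > r"
      then have "K \<inter> {y. y \<bullet> h \<le> x (n + 2)} \<subseteq> ?A'" by auto
      then have "emeasure \<mu> (K \<inter> {y. y \<bullet> h \<le> x (n + 2)}) \<le> emeasure \<mu> ?A'"
        using KB by (intro emeasure_mono) auto
      then have "ennreal (1 - 1 / real (n + 2 + 2)) \<le> emeasure \<mu> ?A'" using x(2)[of "n + 2"] by (rule order_trans[rotated])
      then have "ennreal (1 - 1 / real (n + 2 + 2)) + ennreal a \<le> emeasure \<mu> ?A' + emeasure \<mu> ?A"
        using a by (intro add_mono) auto
      also have "\<dots> = emeasure \<mu> (?A' \<union> ?A)" using KB by (intro plus_emeasure) auto
      also have "?A' \<union> ?A = K" by auto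
      finally have "ennreal (1 - 1 / real (n + 2 + 2) + a) \<le> ennreal 1"
        using a K(2) by (subst ennreal_plus) auto
      then show False using n by (subst (asm) ennreal_le_iff) auto
    qed
    then show ?thesis by blast
  qed
  \<comment> \<open>\<open>n\<close> depends on \<open>K\<close> and \<open>L\<close> alone: only
    finitely many inequalities then constrain \<open>c\<close>, and \<open>Q\<close> is chosen last,
    for that \<open>c\<close>.\<close>
  then obtain n where n: "x (n + 2) > B - w 0 + x 2" by blast
  obtain c :: real where c: "1/2 < c" "c < 1"
    "\<And>k. k < n + 1 \<Longrightarrow> sqrt (1 / real (k + 4)) * sqrt (1 / real (k + 2))
      + sqrt (1 - 1 / real (k + 3)) * sqrt (c - 1 / real (k + 3)) > 1"
    using log_convex_levels[of "n + 1"] by blast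
  obtain Q where Q: "H_convex H Q" "ennreal c \<le> emeasure \<mu> Q" "emeasure \<mu> Q \<le> 1"
      "emeasure \<mu> (midset K Q) \<le> 1" "emeasure \<mu> (midset L Q) \<le> 1"
    using Q[of c] c by auto
  obtain q where q: "emeasure \<mu> Q = ennreal q" "q \<ge> 0"
    using Q(3) by (cases "emeasure \<mu> Q") (auto simp: top_unique)
  have cq: "c \<le> q" using Q(2) q by (simp add: ennreal_le_iff)
  then obtain y where y: "\<And>k. ennreal (1 / real (k + 2)) \<le> emeasure \<mu> (Q \<inter> {z. z \<bullet> h \<ge> y k})"
      "\<And>k. ennreal (q - 1 / real (k + 2)) \<le> emeasure \<mu> (Q \<inter> {z. z \<bullet> h \<le> y k})"
    using quantile_sequence[of Q q h] Q(1) q c by auto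
  have yc: "ennreal (c - 1 / real (k + 2)) \<le> emeasure \<mu> (Q \<inter> {z. z \<bullet> h \<le> y k})" for k
    using y(2)[of k] cq by (meson diff_right_mono ennreal_leI order_trans)
  have pos: "c - 1 / real (k + 3) > 0" "1 - 1 / real (k + 3) > 0" for k
  proof -
    have "1 / real (k + 3) < 1 / 2" by (simp add: field_simps)
    then show "c - 1 / real (k + 3) > 0" "1 - 1 / real (k + 3) > 0" using c(1,2) by linarith+
  qed
  have stepK: "x (k + 2) + y k \<le> x (k + 1) + y (k + 1)" if "k < n + 1" for k
    using x(1)[of "k + 2"] y(1)[of k] x(2)[of "k + 1"] yc[of "k + 1"] pos[of k] c(3)[OF that]
    by (intro tail_comparison[OF K(1) Q(1,4),
          where a' = "1 / real (k + 4)" and b' = "1 / real (k + 2)"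
          and a = "1 - 1 / real (k + 3)" and b = "c - 1 / real (k + 3)"])
      (simp_all add: add.commute)
  have stepL: "w k + y (k + 2) \<le> w (k + 1) + y (k + 1)" if "k < n + 1" for k
    using w(1)[of k] y(1)[of "k + 2"] w(2)[of "k + 1"] yc[of "k + 1"] pos[of k] c(3)[OF that]
    by (intro tail_comparison[OF L(1) Q(1,5),
          where a' = "1 / real (k + 2)" and b' = "1 / real (k + 4)"
          and a = "1 - 1 / real (k + 3)" and b = "c - 1 / real (k + 3)"])
      (simp_all add: add.commute mult.commute)
  \<comment> \<open>Adding \<open>stepK\<close> at \<open>k + 1\<close> and \<open>stepL\<close> at
    \<open>k\<close> cancels the quantiles of \<open>Q\<close> and leaves
    \<open>x (k + 3) - x (k + 2) \<le> w (k + 1) - w k\<close>, hence the shift by two.\<close>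
  have "x (k + 2) - x 2 \<le> w k - w 0" if "k \<le> n" for k
    using that
  proof (induction k)
    case (Suc k)
    then show ?case using stepK[of "k + 1"] stepL[of k] by simp
  qed (simp add: numeral_2_eq_2)
  from this[of n] n wB[of n] show False by simp
qed

text \<open>The cuts at height \<open>n\<close> in all directions of the finite set \<open>H\<close>
  increase to \<open>K\<close>, so their measures increase to that of \<open>K\<close>. Every strict
  lower bound survives; the full measure may be out of reach.\<close>

lemma truncation_exists:
  assumes "H_convex H K" "c < emeasure \<mu> K"
  shows "\<exists>L\<subseteq>K. H_convex H L \<and> (\<forall>h\<in>H. bounded_in L h) \<and> c < emeasure \<mu> L"
proof -
  define A where "A n = K \<inter> {x. \<forall>h\<in>H. x \<bullet> h \<le> real n}" for n :: nat
  have HA: "H_convex H (A n)" for n unfolding A_def using assms(1) by (intro H_convex_truncate) auto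
  have "incseq A" by (force simp: A_def incseq_def intro: order_trans)
  then have "(SUP n. emeasure \<mu> (A n)) = emeasure \<mu> (\<Union>n. A n)"
    using HA H_convex_borel by (intro SUP_emeasure_incseq) auto
  also have "(\<Union>n. A n) = K"
  proof -
    have "x \<in> (\<Union>n. A n)" if "x \<in> K" for x
    proof -
      obtain n :: nat where n: "(\<Sum>h\<in>H. \<bar>x \<bullet> h\<bar>) \<le> real n" using real_arch_simple by blast
      have "x \<bullet> h \<le> real n" if "h \<in> H" for h
        using member_le_sum[of h H "\<lambda>h. \<bar>x \<bullet> h\<bar>"] finite_H that n by auto
      then show ?thesis using \<open>x \<in> K\<close> by (auto simp: A_def)
    qed
    then show ?thesis by (auto simp: A_def)
  qed
  finally have "c < (SUP n. emeasure \<mu> (A n))" using assms(2) by simp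
  then obtain n where "c < emeasure \<mu> (A n)" by (auto simp: less_SUP_iff)
  moreover have "\<forall>h\<in>H. bounded_in (A n) h" by (auto simp: A_def bounded_in_def bdd_above_def)
  ultimately show ?thesis using HA by (auto intro!: exI[of _ "A n"] simp: A_def)
qed

text \<open>Cutting off null tails in finitely many directions loses no measure. Where the result is
  still unbounded it has mass in every tail, as the comparison of quantiles requires.\<close>

lemma essential_truncation:
  assumes "H_convex H K"
  shows "\<exists>L\<subseteq>K. H_convex H L \<and> emeasure \<mu> L = emeasure \<mu> K \<and>
    (\<forall>h\<in>H. bounded_in L h \<or> (\<forall>r. emeasure \<mu> (L \<inter> {y. y \<bullet> h > r}) > 0))"
proof -
  define B where "B = {h\<in>H. \<exists>r. emeasure \<mu> (K \<inter> {y. y \<bullet> h > r}) = 0}"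
  have "\<forall>h\<in>B. \<exists>r. emeasure \<mu> (K \<inter> {y. y \<bullet> h > r}) = 0" by (auto simp: B_def)
  then obtain r where r: "\<And>h. h \<in> B \<Longrightarrow> emeasure \<mu> (K \<inter> {y. y \<bullet> h > r h}) = 0" by metis
  define L where "L = K \<inter> {x. \<forall>h\<in>B. x \<bullet> h \<le> r h}"
  have HL: "H_convex H L" unfolding L_def using assms by (intro H_convex_truncate) (auto simp: B_def)
  have m: "K \<in> sets borel" "L \<in> sets borel" using assms HL H_convex_borel by auto
  have "finite B" using finite_H by (auto simp: B_def)
  define N where "N = (\<Union>h\<in>B. K \<inter> {y. y \<bullet> h > r h})"
  have N: "N \<in> null_sets \<mu>" unfolding N_def
    using \<open>finite B\<close> r m by (intro null_sets_UN' countable_finite) (auto simp: null_sets_def)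
  have eq: "emeasure \<mu> (L \<inter> A) = emeasure \<mu> (K \<inter> A)" if "A \<in> sets borel" for A
  proof -
    have "L = K - N" by (auto simp: L_def N_def not_less)
    then have "L \<inter> A = K \<inter> A - N" by auto
    then show ?thesis using N m that by (simp add: emeasure_Diff_null_set)
  qed
  have "bounded_in L h \<or> (\<forall>r. emeasure \<mu> (L \<inter> {y. y \<bullet> h > r}) > 0)" if "h \<in> H" for h
  proof (cases "h \<in> B")
    case True
    then have "bounded_in L h" by (auto simp: L_def bounded_in_def bdd_above_def)
    then show ?thesis by simp
  next
    case False
    then have "emeasure \<mu> (L \<inter> {y. y \<bullet> h > r}) > 0" for r
      using that by (subst eq) (auto simp: B_def zero_less_iff_neq_zero)
    then show ?thesis by simp
  qed
  moreover have "emeasure \<mu> L = emeasure \<mu> K" using eq[of UNIV] by simp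
  ultimately show ?thesis using HL by (intro exI[of _ L]) (auto simp: L_def)
qed

section \<open>The Helly theorem\<close>

text \<open>If every \<open>i\<close> admits a bounded set, the bounded case at level one suffices.
  Otherwise the sets at bad indices are unbounded in the same directions, and
  \<open>common_unbounded_case\<close> applies with one bad index as \<open>u\<close>.\<close>

lemma helly_step:
  assumes fin: "finite \<F>" and conv: "\<And>F. F \<in> \<F> \<Longrightarrow> convex F" and card: "card H < card \<F>"
    and ex: "\<And>i. i \<in> \<F> \<Longrightarrow> \<exists>K. H_convex H K \<and> K \<subseteq> \<Inter>(\<F> - {i}) \<and> emeasure \<mu> K \<ge> 1"
  shows "\<exists>K. H_convex H K \<and> K \<subseteq> \<Inter>\<F> \<and> emeasure \<mu> K \<ge> 1"
proof -
  \<comment> \<open>Truncation yields bounded sets of measure above \<open>c\<close>, to which the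
    bounded case applies. The results later serve as \<open>Q\<close> in the comparison of
    quantiles.\<close>
  have approx: "\<exists>Q. H_convex H Q \<and> Q \<subseteq> \<Inter>\<F> \<and> ennreal c \<le> emeasure \<mu> Q" if c: "0 < c" "c < 1" for c
  proof -
    define ok where "ok i L \<longleftrightarrow> H_convex H L \<and> L \<subseteq> \<Inter>(\<F> - {i}) \<and> ennreal c \<le> emeasure \<mu> L
        \<and> (\<forall>h\<in>H. bounded_in L h)" for i L
    have "\<exists>L. ok i L" if "i \<in> \<F>" for i
    proof -
      obtain K where K: "H_convex H K" "K \<subseteq> \<Inter>(\<F> - {i})" "emeasure \<mu> K \<ge> 1" using ex[OF \<open>i \<in> \<F>\<close>] by blast
      have "ennreal c < 1" using c by (simp add: ennreal_less_one_iff)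
      then have "ennreal c < emeasure \<mu> K" using K(3) by (rule less_le_trans)
      then obtain L where "L \<subseteq> K" "H_convex H L" "\<forall>h\<in>H. bounded_in L h" "ennreal c < emeasure \<mu> L"
        using truncation_exists[OF K(1)] by blast
      then show ?thesis using K(2) by (intro exI[of _ L]) (auto simp: ok_def intro: less_imp_le)
    qed
    then obtain K where "\<And>i. i \<in> \<F> \<Longrightarrow> ok i (K i)" by metis
    then show ?thesis by (intro bounded_case[of \<F> c \<F> K] conv c fin card) (simp_all add: ok_def)
  qed
  \<comment> \<open>Quantifying over all sets rather than fixing a choice makes the failure of
    \<open>good i\<close> a bound on every H-convex subset of \<open>\<Inter>(\<F> - {i})\<close>:
    one of measure above one could be truncated to a bounded witness.\<close>
  define good where "good i \<longleftrightarrow>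
    (\<exists>K. H_convex H K \<and> K \<subseteq> \<Inter>(\<F> - {i}) \<and> emeasure \<mu> K \<ge> 1 \<and> (\<forall>h\<in>H. bounded_in K h))" for i
  have le1: "emeasure \<mu> K \<le> 1" if bad: "\<not> good i" and K: "H_convex H K" "K \<subseteq> \<Inter>(\<F> - {i})" for i K
  proof (rule ccontr)
    assume "\<not> emeasure \<mu> K \<le> 1"
    then have "1 < emeasure \<mu> K" by (simp add: not_le)
    then obtain L where "L \<subseteq> K" "H_convex H L" "\<forall>h\<in>H. bounded_in L h" "1 < emeasure \<mu> L"
      using truncation_exists[OF K(1)] by blast
    then have "good i" using K(2) by (auto simp: good_def intro!: exI[of _ L])
    then show False using bad by simp
  qed
  \<comment> \<open>Bounded witnesses are taken wherever they exist; elsewhere each direction is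
    bounded or has mass in every tail.\<close>
  define ok where "ok i K \<longleftrightarrow> H_convex H K \<and> K \<subseteq> \<Inter>(\<F> - {i}) \<and> emeasure \<mu> K \<ge> 1 \<and>
    (if good i then \<forall>h\<in>H. bounded_in K h
     else \<forall>h\<in>H. bounded_in K h \<or> (\<forall>r. emeasure \<mu> (K \<inter> {y. y \<bullet> h > r}) > 0))" for i K
  have "\<exists>K. ok i K" if i: "i \<in> \<F>" for i
  proof (cases "good i")
    case True
    then show ?thesis unfolding ok_def good_def by simp
  next
    case False
    obtain K where K: "H_convex H K" "K \<subseteq> \<Inter>(\<F> - {i})" "emeasure \<mu> K \<ge> 1" using ex[OF i] by blast
    then obtain L where "L \<subseteq> K" "H_convex H L" "emeasure \<mu> L = emeasure \<mu> K"
        "\<forall>h\<in>H. bounded_in L h \<or> (\<forall>r. emeasure \<mu> (L \<inter> {y. y \<bullet> h > r}) > 0)"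
      using essential_truncation[OF K(1)] by blast
    then show ?thesis using False K by (intro exI[of _ L]) (auto simp: ok_def)
  qed
  then obtain K where K: "\<And>i. i \<in> \<F> \<Longrightarrow> ok i (K i)" by metis
  have K': "H_convex H (K i)" "K i \<subseteq> \<Inter>(\<F> - {i})" "ennreal 1 \<le> emeasure \<mu> (K i)" if "i \<in> \<F>" for i
    using K[OF that] by (simp_all add: ok_def)
  have good_bounded: "\<forall>h\<in>H. bounded_in (K i) h" if "i \<in> \<F>" "good i" for i
    using K[OF that(1)] that(2) by (simp add: ok_def)
  have "\<exists>P. H_convex H P \<and> P \<subseteq> \<Inter>\<F> \<and> ennreal 1 \<le> emeasure \<mu> P"
  proof (cases "\<forall>i\<in>\<F>. good i")
    case True
    then show ?thesis using good_bounded K' by (intro bounded_case[of \<F> 1 \<F> K] conv fin card) simp_all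
  next
    case False
    then obtain u where u: "u \<in> \<F>" "\<not> good u" by blast
    \<comment> \<open>The midset of \<open>K j\<close> with a set inside \<open>\<Inter>\<F>\<close>
      stays in \<open>\<Inter>(\<F> - {j})\<close>, so for bad \<open>j\<close> its measure is at
      most one. Used in both orders, the claim gives one common set of unbounded directions.\<close>
    have transfer: "\<not> bounded_in (K l) h"
      if i: "i \<in> \<F>" "\<not> good i" and l: "l \<in> \<F>" "\<not> good l" and h: "h \<in> H" "\<not> bounded_in (K i) h" for i l h
    proof (rule unbounded_transfer[of "K i"])
      have mid: "emeasure \<mu> (midset (K j) Q) \<le> 1"
        if j: "j \<in> \<F>" "\<not> good j" and Q: "H_convex H Q" "Q \<subseteq> \<Inter>\<F>" for j Q
      proof (rule le1[OF j(2)])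
        show "H_convex H (midset (K j) Q)" using K'(1)[OF j(1)] Q(1) by (rule H_convex_midset)
        have "convex (\<Inter>(\<F> - {j}))" using conv by (intro convex_Inter) auto
        then show "midset (K j) Q \<subseteq> \<Inter>(\<F> - {j})"
          using K'(2)[OF j(1)] Q(2) by (intro midset_subset_convex) auto
      qed
      show "\<exists>Q. H_convex H Q \<and> ennreal c \<le> emeasure \<mu> Q \<and> emeasure \<mu> Q \<le> 1
          \<and> emeasure \<mu> (midset (K i) Q) \<le> 1 \<and> emeasure \<mu> (midset (K l) Q) \<le> 1"
        if c: "0 < c" "c < 1" for c
      proof -
        obtain Q where Q: "H_convex H Q" "Q \<subseteq> \<Inter>\<F>" "ennreal c \<le> emeasure \<mu> Q" using approx[OF c] by blast
        have "emeasure \<mu> Q \<le> 1" using Q(2) by (intro le1[OF i(2) Q(1)]) auto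
        then show ?thesis using Q mid[OF i Q(1,2)] mid[OF l Q(1,2)] by blast
      qed
      have one: "emeasure \<mu> (K j) = 1" if j: "j \<in> \<F>" "\<not> good j" for j
        using le1[OF j(2) K'(1,2)[OF j(1)]] K'(3)[OF j(1)] by simp
      show "emeasure \<mu> (K i) = 1" "emeasure \<mu> (K l) = 1" using one i l by auto
      show "emeasure \<mu> (K i \<inter> {y. y \<bullet> h > r}) > 0" for r
        using K[OF i(1)] i(2) h by (auto simp: ok_def)
    qed (use K' i l in auto)
    define Z where "Z = {h\<in>H. \<not> bounded_in (K u) h}"
    \<comment> \<open>Otherwise \<open>K u\<close> would itself be a bounded witness for
      \<open>good u\<close>.\<close>
    have "Z \<noteq> {}"
    proof
      assume "Z = {}"
      then have "good u" using K'[OF u(1)] unfolding good_def by (intro exI[of _ "K u"]) (auto simp: Z_def)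
      then show False using u by simp
    qed
    then obtain g where g: "g \<in> Z" by blast
    have ins: "insert u (\<F> - {u}) = \<F>" using u by auto
    show ?thesis
    proof (rule common_unbounded_case[of \<F> 1 "\<F> - {u}" u K g Z])
      show "card H \<le> card (\<F> - {u})" using card u fin by simp
      fix i assume i: "i \<in> \<F> - {u}"
      show "(\<forall>h\<in>H. bounded_in (K i) h) \<or> (\<forall>h\<in>H. bounded_in (K i) h \<longleftrightarrow> h \<notin> Z)"
      proof (cases "good i")
        case True
        then show ?thesis using good_bounded i by auto
      next
        case False
        have "bounded_in (K i) h \<longleftrightarrow> h \<notin> Z" if "h \<in> H" for h
          using transfer[of i u h] transfer[of u i h] that u i False by (auto simp: Z_def)
        then show ?thesis by blast
      qed
    qed (use conv fin g K' in \<open>simp_all only: ins\<close>, use conv fin g K' in \<open>auto simp: Z_def\<close>)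
  qed
  then show ?thesis by simp
qed

text \<open>Induction on subfamilies by inclusion: those with at most \<open>card H\<close> members
  are covered by \<open>small\<close>, larger ones follow by \<open>helly_step\<close> from those
  with one member removed.\<close>

lemma helly_H_convex:
  assumes "finite \<F>" and conv: "\<And>F. F \<in> \<F> \<Longrightarrow> convex F"
    and small: "\<And>\<G>. \<G> \<subseteq> \<F> \<Longrightarrow> card \<G> \<le> card H \<Longrightarrow> \<exists>K. H_convex H K \<and> K \<subseteq> \<Inter>\<G> \<and> emeasure \<mu> K \<ge> 1"
  shows "\<exists>K. H_convex H K \<and> K \<subseteq> \<Inter>\<F> \<and> emeasure \<mu> K \<ge> 1"
proof -
  have "\<exists>K. H_convex H K \<and> K \<subseteq> \<Inter>\<G> \<and> emeasure \<mu> K \<ge> 1" if "finite \<G>" "\<G> \<subseteq> \<F>" for \<G>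
    using that
  proof (induction \<G> rule: finite_psubset_induct)
    case (psubset \<G>)
    show ?case
    proof (cases "card \<G> \<le> card H")
      case True
      then show ?thesis using small psubset.prems by blast
    next
      case False
      show ?thesis
      proof (rule helly_step)
        show "finite \<G>" by (rule psubset.hyps)
        show "\<And>F. F \<in> \<G> \<Longrightarrow> convex F" using conv psubset.prems by blast
        show "card H < card \<G>" using False by simp
        show "\<exists>K. H_convex H K \<and> K \<subseteq> \<Inter>(\<G> - {i}) \<and> emeasure \<mu> K \<ge> 1" if "i \<in> \<G>" for i
          using psubset.prems that by (intro psubset.IH) auto
      qed
    qed
  qed
  then show ?thesis using assms(1) by blast
qed

end

section \<open>Consequences of the half-sphere condition\<close>

theorem theorem2p10:
  fixes H :: "'a::euclidean_space set"
    and \<F> :: "'a set set"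
    and \<mu> :: "'a measure"
  assumes "finite H"
    and "H \<subseteq> sphere 0 1"
    and "\<And>v. v \<in> sphere 0 1 \<Longrightarrow> \<not> H \<subseteq> closed_half_sphere v"
    and "\<And>A B. H_convex H A \<Longrightarrow> H_convex H B \<Longrightarrow> H_convex H (A + B)"
    and "finite \<F>"
    and "\<And>F. F \<in> \<F> \<Longrightarrow> convex F"
    and "log_concave_measure \<mu>"
    and "\<And>\<G>. \<G> \<subseteq> \<F> \<Longrightarrow> card \<G> \<le> card H \<Longrightarrow>
           \<exists>K. H_convex H K \<and> K \<subseteq> \<Inter>\<G> \<and> emeasure \<mu> K \<ge> 1"
  shows "\<exists>K. H_convex H K \<and> K \<subseteq> \<Inter>\<F> \<and> emeasure \<mu> K \<ge> 1"
proof -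
  \<comment> \<open>The half-sphere condition for the normalised vector carries over to every
    nonzero vector by scaling.\<close>
  have ex_neg: "\<exists>h\<in>H. h \<bullet> v < 0" if "v \<noteq> 0" for v
  proof -
    have "sgn v \<in> sphere 0 1" using that by (simp add: norm_sgn)
    then obtain h where h: "h \<in> H" "h \<bullet> sgn v < 0"
      using assms(2,3) by (fastforce simp: closed_half_sphere_def)
    then have "h \<bullet> v < 0" using that by (simp add: sgn_div_norm field_simps)
    then show ?thesis using h by blast
  qed
  interpret H_setting H \<mu>
  proof
    \<comment> \<open>Any nonzero vector yields some \<open>h \<in> H\<close>, and \<open>h\<close>
      in turn yields a second direction on its opposite side.\<close>
    obtain v :: 'a where "v \<noteq> 0" using nonzero_Basis nonempty_Basis by blast
    then obtain h where h: "h \<in> H" using ex_neg by blast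
    then have h1: "h \<bullet> h = 1" using assms(2) by (auto simp: norm_eq_1)
    then obtain h' where h': "h' \<in> H" "h' \<bullet> h < 0" using ex_neg[of h] by force
    then have "h' \<noteq> h" using h1 by auto
    then have "card {h, h'} = 2" by simp
    then show "2 \<le> card H" using card_mono[OF assms(1), of "{h, h'}"] h h' by simp
    \<comment> \<open>A nonzero \<open>x\<close> violates one of these halfspaces: the direction
      found for \<open>- x\<close> has positive inner product with \<open>x\<close>.\<close>
    have "{0} = \<Inter>((\<lambda>h. {y. y \<bullet> h \<le> 0}) ` H)"
    proof -
      have "x = 0" if "\<forall>h\<in>H. x \<bullet> h \<le> 0" for x
        using ex_neg[of "- x"] that by (force simp: inner_commute)
      then show ?thesis by auto
    qed
    moreover have "\<forall>S\<in>(\<lambda>h. {y. y \<bullet> h \<le> 0}) ` H. H_halfspace H S" by (auto simp: H_halfspace_def)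
    ultimately show "H_convex H {0}" unfolding H_convex_def by blast
  qed (use assms in auto)
  show ?thesis by (rule helly_H_convex[OF assms(5,6,8)])
qed

end
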